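(* Let $R$ be a ring of the standard form below and suppose the list $[(q_1,n_1),\dots,(q_t,n_t)]$ is separating. Then the partition $\mathcal P_{\rm hom}$ induced by the normalized homogeneous weight equals the partition $\mathcal H'$. Consequently $\mathcal P_{\rm hom}$ is reflexive, and its left and right duals (which do not depend on the generating character) both equal the dual of $\mathcal H'$, namely the partition with blocks $\mathrm{rad}(R)\setminus\{0\}$, $\{0\}$, and $Q_m=\{a\in R\setminus\mathrm{rad}(R):|\{j:a_{i,j}\notin\mathrm{rad}(R_{i,j})\}|=m_i\ \forall i\}$ for $m\in\mathcal M\setminus\{0\}$ (empty sets discarded). Moreover, if $R=\mathrm{soc}(R)$ (i.e. $R$ is semisimple), then $\mathcal P_{\rm hom}$ coincides with the product of the Hamming partitions on the $R_i$ and is self-dual.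
   Context: Standard form: $R=R_1\times\cdots\times R_t$, $R_i=R_{i,1}\times\cdots\times R_{i,n_i}$, each $R_{i,j}$ a finite local Frobenius ring with $|R_{i,j}/\mathrm{rad}(R_{i,j})|=|\mathrm{soc}(R_{i,j})|=q_i$, and $q_1,\dots,q_t$ distinct ($\mathrm{rad}$ = Jacobson radical, $\mathrm{soc}$ = socle; a finite ring is Frobenius if it has a generating character $\chi$, i.e. a character of its additive group with $r\mapsto(x\mapsto\chi(xr))$ bijective onto the character group). Write $a=(a_1,\dots,a_t)$, $a_i=(a_{i,1},\dots,a_{i,n_i})$, $\mathrm{wt}(a_i)=|\{j:a_{i,j}\ne0\}|$, and $\mathcal M=\{0,\dots,n_1\}\times\cdots\times\{0,\dots,n_t\}$. $\mathcal H'$ is the partition of $R$ with blocks $R\setminus\mathrm{soc}(R)$ (if nonempty) and $P_m=\{a\in\mathrm{soc}(R):\mathrm{wt}(a_i)=m_i\ \forall i\}$, $m\in\mathcal M$. A list $[(q_1,n_1),\dots,(q_t,n_t)]$ is separating if for all $m\ne\ell$ in $\mathcal M$: $\prod_i(q_i-1)^{m_i}\ne\prod_i(q_i-1)^{\ell_i}$ or $\sum_i m_i\not\equiv\sum_i\ell_i\pmod 2$. The normalized homogeneous weight is the unique $\omega:R\to\mathbb Q$ with $\omega(0)=0$, $\omega(x)=\omega(y)$ if $Rx=Ry$, and $\sum_{y\in Rx}\omega(y)=|Rx|$ for $x\ne0$; $\mathcal P_{\rm hom}$ partitions $R$ by equal weight. For a partition $\mathcal P$ of $R$, the right $\chi$-dual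 is given by $a\sim a'$ iff $\sum_{b\in P}\chi(ab)=\sum_{b\in P}\chi(a'b)$ for all blocks $P$; left dual uses $\chi(ba)$. $\mathcal P$ is reflexive if the left $\chi$-dual of its right $\chi$-dual equals $\mathcal P$ (equivalently, $\mathcal P$ and its right dual have equally many blocks), and self-dual if it equals its right $\chi$-dual. *)

theory Defs
  imports Complex_Main "HOL-Algebra.Algebra"
begin

definition left_ideal :: "('a, 'm) ring_scheme \<Rightarrow> 'a set \<Rightarrow> bool" where
  "left_ideal R I \<longleftrightarrow> I \<subseteq> carrier R \<and> \<zero>\<^bsub>R\<^esub> \<in> I
     \<and> (\<forall>x\<in>I. \<forall>y\<in>I. x \<oplus>\<^bsub>R\<^esub> y \<in> I) \<and> (\<forall>x\<in>I. \<ominus>\<^bsub>R\<^esub> x \<in> I)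
     \<and> (\<forall>r\<in>carrier R. \<forall>x\<in>I. r \<otimes>\<^bsub>R\<^esub> x \<in> I)"

definition maximal_left_ideal :: "('a, 'm) ring_scheme \<Rightarrow> 'a set \<Rightarrow> bool" where
  "maximal_left_ideal R I \<longleftrightarrow> left_ideal R I \<and> I \<noteq> carrier R
     \<and> (\<forall>J. left_ideal R J \<and> I \<subseteq> J \<and> J \<noteq> carrier R \<longrightarrow> J = I)"

definition minimal_left_ideal :: "('a, 'm) ring_scheme \<Rightarrow> 'a set \<Rightarrow> bool" where
  "minimal_left_ideal R I \<longleftrightarrow> left_ideal R I \<and> I \<noteq> {\<zero>\<^bsub>R\<^esub>}
     \<and> (\<forall>J. left_ideal R J \<and> J \<subseteq> I \<and> J \<noteq> {\<zero>\<^bsub>R\<^esub>} \<longrightarrow> J = I)"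

definition jrad :: "('a, 'm) ring_scheme \<Rightarrow> 'a set" where
  "jrad R = carrier R \<inter> \<Inter>{I. maximal_left_ideal R I}"

text \<open>Socle: sum of all minimal left ideals (= smallest left ideal containing them).\<close>
definition lsoc :: "('a, 'm) ring_scheme \<Rightarrow> 'a set" where
  "lsoc R = \<Inter>{J. left_ideal R J \<and> (\<forall>I. minimal_left_ideal R I \<longrightarrow> I \<subseteq> J)}"

definition local_ring :: "('a, 'm) ring_scheme \<Rightarrow> bool" where
  "local_ring R \<longleftrightarrow> (\<exists>!I. maximal_left_ideal R I)"

definition add_chars :: "('a, 'm) ring_scheme \<Rightarrow> ('a \<Rightarrow> complex) set" where
  "add_chars R = {f \<in> extensional (carrier R). (\<forall>x\<in>carrier R. f x \<noteq> 0)
      \<and> (\<forall>x\<in>carrier R. \<forall>y\<in>carrier R. f (x \<oplus>\<^bsub>R\<^esub> y) = f x * f y)}"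

definition generating_char :: "('a, 'm) ring_scheme \<Rightarrow> ('a \<Rightarrow> complex) \<Rightarrow> bool" where
  "generating_char R \<chi> \<longleftrightarrow> \<chi> \<in> add_chars R
     \<and> bij_betw (\<lambda>r. restrict (\<lambda>x. \<chi> (x \<otimes>\<^bsub>R\<^esub> r)) (carrier R)) (carrier R) (add_chars R)"

definition frobenius :: "('a, 'm) ring_scheme \<Rightarrow> bool" where
  "frobenius R \<longleftrightarrow> (\<exists>\<chi>. generating_char R \<chi>)"

definition is_hom_weight :: "('a, 'm) ring_scheme \<Rightarrow> ('a \<Rightarrow> rat) \<Rightarrow> bool" where
  "is_hom_weight R w \<longleftrightarrow> w \<in> extensional (carrier R) \<and> w \<zero>\<^bsub>R\<^esub> = 0
     \<and> (\<forall>x\<in>carrier R. \<forall>y\<in>carrier R.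
          (\<lambda>r. r \<otimes>\<^bsub>R\<^esub> x) ` carrier R = (\<lambda>r. r \<otimes>\<^bsub>R\<^esub> y) ` carrier R \<longrightarrow> w x = w y)
     \<and> (\<forall>x\<in>carrier R. x \<noteq> \<zero>\<^bsub>R\<^esub> \<longrightarrow>
          (\<Sum>y\<in>(\<lambda>r. r \<otimes>\<^bsub>R\<^esub> x) ` carrier R. w y) = of_nat (card ((\<lambda>r. r \<otimes>\<^bsub>R\<^esub> x) ` carrier R)))"

definition hom_weight :: "('a, 'm) ring_scheme \<Rightarrow> 'a \<Rightarrow> rat" where
  "hom_weight R = (THE w. is_hom_weight R w)"

definition P_hom :: "('a, 'm) ring_scheme \<Rightarrow> 'a set set" where
  "P_hom R = (\<lambda>x. {y \<in> carrier R. hom_weight R y = hom_weight R x}) ` carrier R"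

definition right_dual :: "('a, 'm) ring_scheme \<Rightarrow> ('a \<Rightarrow> complex) \<Rightarrow> 'a set set \<Rightarrow> 'a set set" where
  "right_dual R \<chi> P = (\<lambda>a. {a' \<in> carrier R. \<forall>B\<in>P.
       (\<Sum>b\<in>B. \<chi> (a \<otimes>\<^bsub>R\<^esub> b)) = (\<Sum>b\<in>B. \<chi> (a' \<otimes>\<^bsub>R\<^esub> b))}) ` carrier R"

definition left_dual :: "('a, 'm) ring_scheme \<Rightarrow> ('a \<Rightarrow> complex) \<Rightarrow> 'a set set \<Rightarrow> 'a set set" where
  "left_dual R \<chi> P = (\<lambda>a. {a' \<in> carrier R. \<forall>B\<in>P.
       (\<Sum>b\<in>B. \<chi> (b \<otimes>\<^bsub>R\<^esub> a)) = (\<Sum>b\<in>B. \<chi> (b \<otimes>\<^bsub>R\<^esub> a'))}) ` carrier R"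

definition reflexive_partition :: "('a, 'm) ring_scheme \<Rightarrow> ('a \<Rightarrow> complex) \<Rightarrow> 'a set set \<Rightarrow> bool" where
  "reflexive_partition R \<chi> P \<longleftrightarrow> left_dual R \<chi> (right_dual R \<chi> P) = P"

definition self_dual_partition :: "('a, 'm) ring_scheme \<Rightarrow> ('a \<Rightarrow> complex) \<Rightarrow> 'a set set \<Rightarrow> bool" where
  "self_dual_partition R \<chi> P \<longleftrightarrow> right_dual R \<chi> P = P"

text \<open>Components are indexed by (i,j) with i < t, j < n i; elements of the product are
  functions a with a i j the (i,j)-component, and undefined outside the index range.\<close>

definition in_idx :: "nat \<Rightarrow> (nat \<Rightarrow> nat) \<Rightarrow> nat \<Rightarrow> nat \<Rightarrow> bool" where
  "in_idx t n i j \<longleftrightarrow> i < t \<and> j < n i"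

definition prod_ring :: "nat \<Rightarrow> (nat \<Rightarrow> nat) \<Rightarrow> (nat \<Rightarrow> nat \<Rightarrow> ('c, 'm) ring_scheme)
    \<Rightarrow> (nat \<Rightarrow> nat \<Rightarrow> 'c) ring" where
  "prod_ring t n S = \<lparr>carrier = {a. \<forall>i j. (in_idx t n i j \<longrightarrow> a i j \<in> carrier (S i j))
                                  \<and> (\<not> in_idx t n i j \<longrightarrow> a i j = undefined)},
     monoid.mult = (\<lambda>a b i j. if in_idx t n i j then a i j \<otimes>\<^bsub>S i j\<^esub> b i j else undefined),
     one = (\<lambda>i j. if in_idx t n i j then \<one>\<^bsub>S i j\<^esub> else undefined),
     ring.zero = (\<lambda>i j. if in_idx t n i j then \<zero>\<^bsub>S i j\<^esub> else undefined),
     ring.add = (\<lambda>a b i j. if in_idx t n i j then a i j \<oplus>\<^bsub>S i j\<^esub> b i j else undefined)\<rparr>"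

text \<open>The index set M, as functions m with m i \<le> n i for i < t (values at i \<ge> t irrelevant).\<close>
definition in_M :: "nat \<Rightarrow> (nat \<Rightarrow> nat) \<Rightarrow> (nat \<Rightarrow> nat) \<Rightarrow> bool" where
  "in_M t n m \<longleftrightarrow> (\<forall>i<t. m i \<le> n i)"

definition separating :: "nat \<Rightarrow> (nat \<Rightarrow> nat) \<Rightarrow> (nat \<Rightarrow> nat) \<Rightarrow> bool" where
  "separating t n q \<longleftrightarrow> (\<forall>m l. in_M t n m \<longrightarrow> in_M t n l \<longrightarrow> (\<exists>i<t. m i \<noteq> l i) \<longrightarrow>
      (\<Prod>i<t. (int (q i) - 1) ^ m i) \<noteq> (\<Prod>i<t. (int (q i) - 1) ^ l i)
      \<or> (\<Sum>i<t. m i) mod 2 \<noteq> (\<Sum>i<t. l i) mod 2)"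

definition wt :: "(nat \<Rightarrow> nat) \<Rightarrow> (nat \<Rightarrow> nat \<Rightarrow> ('c, 'm) ring_scheme) \<Rightarrow> (nat \<Rightarrow> nat \<Rightarrow> 'c) \<Rightarrow> nat \<Rightarrow> nat" where
  "wt n S a i = card {j. j < n i \<and> a i j \<noteq> \<zero>\<^bsub>S i j\<^esub>}"

definition H' :: "nat \<Rightarrow> (nat \<Rightarrow> nat) \<Rightarrow> (nat \<Rightarrow> nat \<Rightarrow> ('c, 'm) ring_scheme) \<Rightarrow> (nat \<Rightarrow> nat \<Rightarrow> 'c) set set" where
  "H' t n S = {B. B \<noteq> {} \<and>
      (B = carrier (prod_ring t n S) - lsoc (prod_ring t n S)
       \<or> (\<exists>m. in_M t n m \<and> B = {a \<in> lsoc (prod_ring t n S). \<forall>i<t. wt n S a i = m i}))}"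

definition H'_dual :: "nat \<Rightarrow> (nat \<Rightarrow> nat) \<Rightarrow> (nat \<Rightarrow> nat \<Rightarrow> ('c, 'm) ring_scheme) \<Rightarrow> (nat \<Rightarrow> nat \<Rightarrow> 'c) set set" where
  "H'_dual t n S = {B. B \<noteq> {} \<and>
      (B = jrad (prod_ring t n S) - {\<zero>\<^bsub>prod_ring t n S\<^esub>}
       \<or> B = {\<zero>\<^bsub>prod_ring t n S\<^esub>}
       \<or> (\<exists>m. in_M t n m \<and> (\<exists>i<t. m i \<noteq> 0) \<and>
            B = {a \<in> carrier (prod_ring t n S) - jrad (prod_ring t n S).
                   \<forall>i<t. card {j. j < n i \<and> a i j \<notin> jrad (S i j)} = m i}))}"

definition hamming_prod :: "nat \<Rightarrow> (nat \<Rightarrow> nat) \<Rightarrow> (nat \<Rightarrow> nat \<Rightarrow> ('c, 'm) ring_scheme) \<Rightarrow> (nat \<Rightarrow> nat \<Rightarrow> 'c) set set" where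
  "hamming_prod t n S = {B. B \<noteq> {} \<and>
      (\<exists>m. in_M t n m \<and> B = {a \<in> carrier (prod_ring t n S). \<forall>i<t. wt n S a i = m i})}"

end

theory Submission
  imports Defs
begin

text \<open>
  In a finite local ring whose left socle has as many elements as the residue field, the socle is
  contained in every nonzero left ideal. Hence the function that is \<open>1\<close> at \<open>0\<close>,
  \<open>-1/(q - 1)\<close> on the rest of the socle and \<open>0\<close> elsewhere sums to zero over every nonzero
  left ideal. The product of these functions over all components is \<open>1 - \<omega>\<close> for the
  homogeneous weight \<open>\<omega>\<close>; on the socle its value is
  \<open>\<Prod>\<^sub>i (-1/(q\<^sub>i - 1))\<^bsup>m\<^sub>i\<^esup>\<close>, from which a separating list recovers the \<open>m\<^sub>i\<close>.

  For the duals, a generating character is a product of characters of the components. In each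
  component, its sum over the nonzero elements of the socle is \<open>-1\<close> or \<open>q\<^sub>i - 1\<close>, and its sum over
  the nonradical elements is \<open>-1\<close> or \<open>q\<^sub>i - 1\<close> times its sum over the radical. Hence the sums over
  the blocks are multiples of products of Krawtchouk values; they depend only on the numbers of
  nonradical (respectively nonzero) components, and already those of degree one determine these numbers.
\<close>

section \<open>Left ideals of finite rings\<close>

abbreviation left_principal :: "('a, 'm) ring_scheme \<Rightarrow> 'a \<Rightarrow> 'a set" where
  "left_principal R x \<equiv> (\<lambda>r. r \<otimes>\<^bsub>R\<^esub> x) ` carrier R"

definition left_annihilator :: "('a, 'm) ring_scheme \<Rightarrow> 'a \<Rightarrow> 'a set" where
  "left_annihilator R x = {r \<in> carrier R. r \<otimes>\<^bsub>R\<^esub> x = \<zero>\<^bsub>R\<^esub>}"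

lemma
  assumes "left_ideal R I"
  shows left_ideal_closed: "x \<in> I \<Longrightarrow> x \<in> carrier R"
    and left_ideal_zero: "\<zero>\<^bsub>R\<^esub> \<in> I"
    and left_ideal_add: "x \<in> I \<Longrightarrow> y \<in> I \<Longrightarrow> x \<oplus>\<^bsub>R\<^esub> y \<in> I"
    and left_ideal_minus: "x \<in> I \<Longrightarrow> \<ominus>\<^bsub>R\<^esub> x \<in> I"
    and left_ideal_mult: "r \<in> carrier R \<Longrightarrow> x \<in> I \<Longrightarrow> r \<otimes>\<^bsub>R\<^esub> x \<in> I"
  using assms by (auto simp: left_ideal_def)

lemma left_principal_subset_left_ideal:
  "left_ideal R I \<Longrightarrow> x \<in> I \<Longrightarrow> left_principal R x \<subseteq> I"
  by (auto intro: left_ideal_mult)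

lemma left_ideal_nonzeroE:
  assumes "left_ideal R I" "I \<noteq> {\<zero>\<^bsub>R\<^esub>}"
  obtains x where "x \<in> I" "x \<noteq> \<zero>\<^bsub>R\<^esub>"
  using assms left_ideal_zero[OF assms(1)] by blast

lemma minimal_left_ideal_subset_lsoc: "minimal_left_ideal R I \<Longrightarrow> I \<subseteq> lsoc R"
  by (auto simp: lsoc_def)

lemma lsoc_least:
  assumes "left_ideal R J" "\<And>I. minimal_left_ideal R I \<Longrightarrow> I \<subseteq> J"
  shows "lsoc R \<subseteq> J"
  using assms unfolding lsoc_def by blast

lemma jrad_closed: "x \<in> jrad R \<Longrightarrow> x \<in> carrier R"
  by (simp add: jrad_def)

context ring
begin

lemma left_idealI:
  assumes "I \<subseteq> carrier R" "\<zero> \<in> I" "\<And>x y. x \<in> I \<Longrightarrow> y \<in> I \<Longrightarrow> x \<oplus> y \<in> I"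
    and mult: "\<And>r x. r \<in> carrier R \<Longrightarrow> x \<in> I \<Longrightarrow> r \<otimes> x \<in> I"
  shows "left_ideal R I"
proof -
  have "\<ominus> x \<in> I" if "x \<in> I" for x
    using mult[of "\<ominus> \<one>" x] assms(1) that by (simp add: l_minus subsetD)
  then show ?thesis using assms by (simp add: left_ideal_def)
qed

lemma left_ideal_carrier: "left_ideal R (carrier R)"
  by (simp add: left_ideal_def)

lemma left_ideal_zero_ideal: "left_ideal R {\<zero>}"
  by (simp add: left_ideal_def)

lemma left_ideal_left_principal:
  assumes x: "x \<in> carrier R"
  shows "left_ideal R (left_principal R x)"
proof (rule left_idealI)
  show "\<zero> \<in> left_principal R x"
    by (rule image_eqI[of _ _ \<zero>]) (use x in auto)
qed (use x in \<open>auto simp flip: l_distr m_assoc\<close>)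

lemma left_ideal_left_annihilator:
  assumes "x \<in> carrier R"
  shows "left_ideal R (left_annihilator R x)"
  by (rule left_idealI) (use assms in \<open>auto simp: left_annihilator_def l_distr m_assoc\<close>)

lemma left_principal_self: "x \<in> carrier R \<Longrightarrow> x \<in> left_principal R x"
  by (rule image_eqI[of _ _ \<one>]) auto

lemma left_principal_zero: "left_principal R \<zero> = {\<zero>}"
  by auto

lemma left_principal_eq_zero_iff: "x \<in> carrier R \<Longrightarrow> left_principal R x = {\<zero>} \<longleftrightarrow> x = \<zero>"
  using left_principal_self left_principal_zero by fastforce

lemma left_ideal_one_imp_carrier: "left_ideal R I \<Longrightarrow> \<one> \<in> I \<Longrightarrow> I = carrier R"
  using left_principal_subset_left_ideal[of R I \<one>] by (simp add: left_ideal_def subset_antisym)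

lemma carrier_mult_eq_zero_iff:
  assumes x: "x \<in> carrier R"
  shows "(\<forall>y\<in>carrier R. y \<otimes> x = \<zero>) \<longleftrightarrow> x = \<zero>"
    and "(\<forall>y\<in>carrier R. x \<otimes> y = \<zero>) \<longleftrightarrow> x = \<zero>"
  using l_one[OF x] r_one[OF x] by (auto dest: bspec[OF _ one_closed])

lemma left_ideal_additive_subgroup:
  assumes I: "left_ideal R I"
  shows "additive_subgroup I R"
proof (intro additive_subgroupI add.subgroupI)
  show "I \<noteq> {}" using left_ideal_zero[OF I] by blast
qed (use left_ideal_closed[OF I] left_ideal_minus[OF I] left_ideal_add[OF I] in auto)

lemma left_ideal_Inter:
  assumes "\<J> \<noteq> {}" and ideal: "\<And>J. J \<in> \<J> \<Longrightarrow> left_ideal R J"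
  shows "left_ideal R (\<Inter>\<J>)"
proof (rule left_idealI)
  show "\<Inter>\<J> \<subseteq> carrier R" using \<open>\<J> \<noteq> {}\<close> left_ideal_closed[OF ideal] by blast
  show "\<zero> \<in> \<Inter>\<J>" using left_ideal_zero[OF ideal] by blast
  show "x \<oplus> y \<in> \<Inter>\<J>" if "x \<in> \<Inter>\<J>" "y \<in> \<Inter>\<J>" for x y
    using that left_ideal_add[OF ideal] by blast
  show "r \<otimes> x \<in> \<Inter>\<J>" if "r \<in> carrier R" "x \<in> \<Inter>\<J>" for r x
    using that left_ideal_mult[OF ideal] by blast
qed

lemma left_ideal_lsoc: "left_ideal R (lsoc R)"
  unfolding lsoc_def
proof (rule left_ideal_Inter)
  have "\<forall>I. minimal_left_ideal R I \<longrightarrow> I \<subseteq> carrier R"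
    by (simp add: minimal_left_ideal_def left_ideal_def)
  then show "{J. left_ideal R J \<and> (\<forall>I. minimal_left_ideal R I \<longrightarrow> I \<subseteq> J)} \<noteq> {}"
    using left_ideal_carrier by blast
qed simp

lemma left_ideal_jrad: "left_ideal R (jrad R)"
proof -
  have "left_ideal R (\<Inter>(insert (carrier R) {I. maximal_left_ideal R I}))"
    by (rule left_ideal_Inter) (auto simp: left_ideal_carrier maximal_left_ideal_def)
  then show ?thesis by (simp add: jrad_def)
qed

end

lemma (in abelian_group) sum_multiplicative_over_subgroup:
  fixes g :: "'a \<Rightarrow> 'f :: idom"
  assumes "additive_subgroup H G" "finite H"
    and mult: "\<And>x y. x \<in> H \<Longrightarrow> y \<in> H \<Longrightarrow> g (x \<oplus> y) = g x * g y"
  shows "sum g H = (if \<forall>x\<in>H. g x = 1 then of_nat (card H) else 0)"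
proof (cases "\<forall>x\<in>H. g x = 1")
  case False
  then obtain c where c: "c \<in> H" "g c \<noteq> 1" by blast
  interpret additive_subgroup H G by fact
  have inj: "inj_on (\<lambda>x. c \<oplus> x) H"
    using c(1) a_Hcarr by (auto intro!: inj_onI)
  have "(\<lambda>x. c \<oplus> x) ` H = H"
    by (rule endo_inj_surj[OF \<open>finite H\<close> _ inj]) (use c(1) in auto)
  then have "sum g H = (\<Sum>x\<in>H. g (c \<oplus> x))"
    using sum.reindex[OF inj, of g] by simp
  also have "\<dots> = g c * sum g H"
    using c(1) by (simp add: mult sum_distrib_left)
  finally have "sum g H = 0" using c(2) by simp
  then show ?thesis unfolding if_not_P[OF False] .
qed simp

locale finite_ring = ring R for R (structure) +
  assumes finite_carrier: "finite (carrier R)"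
begin

lemma finite_left_ideal: "left_ideal R I \<Longrightarrow> finite I"
  using finite_subset[OF _ finite_carrier] by (auto simp: left_ideal_def)

lemma card_left_ideal_pos: "left_ideal R I \<Longrightarrow> card I > 0"
  using finite_left_ideal left_ideal_zero by (auto simp: card_gt_0_iff)

lemma finite_left_ideals: "finite {I. left_ideal R I}"
  by (rule finite_subset[of _ "Pow (carrier R)"]) (auto simp: left_ideal_def finite_carrier)

lemma ex_maximal_left_ideal:
  assumes "left_ideal R I" "I \<noteq> carrier R"
  obtains M where "maximal_left_ideal R M" "I \<subseteq> M"
proof -
  let ?\<I> = "{J. left_ideal R J \<and> J \<noteq> carrier R}"
  have "finite ?\<I>" by (rule finite_subset[OF _ finite_left_ideals]) auto
  then obtain M where "M \<in> ?\<I>" "I \<subseteq> M" "\<forall>K\<in>?\<I>. M \<subseteq> K \<longrightarrow> M = K"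
    using finite_has_maximal2[of ?\<I> I] assms by auto
  then show ?thesis by (intro that[of M]) (auto simp: maximal_left_ideal_def)
qed

lemma ex_minimal_left_ideal:
  assumes "left_ideal R I" "I \<noteq> {\<zero>}"
  obtains K where "minimal_left_ideal R K" "K \<subseteq> I"
proof -
  let ?\<I> = "{J. left_ideal R J \<and> J \<noteq> {\<zero>}}"
  have "finite ?\<I>" by (rule finite_subset[OF _ finite_left_ideals]) auto
  then obtain K where "K \<in> ?\<I>" "K \<subseteq> I" "\<forall>J\<in>?\<I>. J \<subseteq> K \<longrightarrow> K = J"
    using finite_has_minimal2[of ?\<I> I] assms by auto
  then show ?thesis by (intro that[of K]) (auto simp: minimal_left_ideal_def)
qed

lemma card_left_principal_mult_left_annihilator:
  assumes x: "x \<in> carrier R"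
  shows "card (left_principal R x) * card (left_annihilator R x) = card (carrier R)"
proof -
  have fibre: "card {r \<in> carrier R. r \<otimes> x = s \<otimes> x} = card (left_annihilator R x)"
    if s: "s \<in> carrier R" for s
  proof (rule bij_betw_same_card[OF bij_betw_byWitness[where f = "\<lambda>r. r \<ominus> s" and f' = "\<lambda>r. r \<oplus> s"]])
    show "(\<lambda>r. r \<ominus> s) ` {r \<in> carrier R. r \<otimes> x = s \<otimes> x} \<subseteq> left_annihilator R x"
      using s x by (auto simp: left_annihilator_def minus_eq l_distr l_minus r_neg)
    show "(\<lambda>r. r \<oplus> s) ` left_annihilator R x \<subseteq> {r \<in> carrier R. r \<otimes> x = s \<otimes> x}"
      using s x by (auto simp: left_annihilator_def l_distr)
  qed (use s in \<open>auto simp: left_annihilator_def minus_eq a_assoc l_neg r_neg\<close>)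
  have "card (carrier R) = (\<Sum>y\<in>left_principal R x. card {r \<in> carrier R. r \<otimes> x = y})"
    using sum.image_gen[OF finite_carrier, of "\<lambda>_. 1::nat" "\<lambda>r. r \<otimes> x"] by simp
  also have "\<dots> = (\<Sum>y\<in>left_principal R x. card (left_annihilator R x))"
    by (rule sum.cong) (auto simp: fibre)
  finally show ?thesis by simp
qed

lemma left_principal_eq_carrier:
  assumes x: "x \<in> carrier R" and "left_annihilator R x = {\<zero>}"
  shows "left_principal R x = carrier R"
  using card_left_principal_mult_left_annihilator[OF x] assms(2) x
  by (intro card_subset_eq finite_carrier) auto

lemma Units_if_left_inverse:
  assumes x: "x \<in> carrier R" and y: "y \<in> carrier R" "y \<otimes> x = \<one>"
  shows "x \<in> Units R" "y \<in> Units R"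
proof -
  have "r = \<zero>" if "r \<in> left_annihilator R y" for r
  proof -
    have r: "r \<in> carrier R" "r \<otimes> y = \<zero>" using that by (auto simp: left_annihilator_def)
    have "r = (r \<otimes> y) \<otimes> x" using r(1) x y by (simp add: m_assoc)
    then show ?thesis using r(2) x by simp
  qed
  then have "left_annihilator R y = {\<zero>}"
    using left_ideal_zero[OF left_ideal_left_annihilator[OF y(1)]] by blast
  then have "left_principal R y = carrier R" by (rule left_principal_eq_carrier[OF y(1)])
  then have "\<one> \<in> left_principal R y" by simp
  then obtain z where z: "z \<in> carrier R" "z \<otimes> y = \<one>" by (rule imageE) auto
  have "z = (z \<otimes> y) \<otimes> x" using z(1) x y by (simp add: m_assoc)
  then have "z = x" using z(2) x by simp
  then show "x \<in> Units R" "y \<in> Units R" using x y z(2) unfolding Units_def by blast+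
qed

lemma eq_0_if_sum_left_principal_eq_0:
  fixes f :: "'a \<Rightarrow> 'f :: field_char_0"
  assumes x: "x \<in> carrier R"
    and f: "\<And>y. y \<in> left_principal R x \<Longrightarrow> f y = (if left_principal R y = left_principal R x then f x else 0)"
    and sum: "sum f (left_principal R x) = 0"
  shows "f x = 0"
proof -
  define G where "G = {y \<in> left_principal R x. left_principal R y = left_principal R x}"
  have "0 = (\<Sum>y\<in>left_principal R x. if left_principal R y = left_principal R x then f x else 0)"
    using sum by (simp only: sum.cong[OF refl f])
  also have "\<dots> = (\<Sum>y\<in>G. f x)"
    unfolding G_def by (rule sum.inter_filter[symmetric]) (simp add: finite_carrier)
  finally have "of_nat (card G) * f x = 0" by simp
  moreover have "x \<in> G" "finite G"
    using left_principal_self[OF x] finite_carrier by (simp_all add: G_def)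
  then have "card G \<noteq> 0" by (auto simp: card_eq_0_iff)
  ultimately show ?thesis by simp
qed

lemma hom_weight_unique:
  assumes w: "is_hom_weight R w" and w': "is_hom_weight R w'"
  shows "w = w'"
proof -
  have "w x = w' x" if "x \<in> carrier R" for x
    using that
  proof (induction "card (left_principal R x)" arbitrary: x rule: less_induct)
    case less
    let ?Rx = "left_principal R x"
    show ?case
    proof (cases "x = \<zero>")
      case True
      then show ?thesis using w w' by (simp add: is_hom_weight_def)
    next
      case False
      have "w y - w' y = (if left_principal R y = ?Rx then w x - w' x else 0)" if y: "y \<in> ?Rx" for y
      proof (cases "left_principal R y = ?Rx")
        case True
        have "y \<in> carrier R" using y less.prems by auto
        then have "w y = w x" "w' y = w' x" using True w w' less.prems unfolding is_hom_weight_def by blast+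
        then show ?thesis using True by simp
      next
        case False
        have "left_principal R y \<subseteq> ?Rx"
          by (rule left_principal_subset_left_ideal[OF left_ideal_left_principal[OF less.prems] y])
        then have "card (left_principal R y) < card ?Rx"
          using False finite_carrier by (intro psubset_card_mono) auto
        then show ?thesis using less.hyps[of y] y less.prems False by auto
      qed
      moreover have "(\<Sum>y\<in>?Rx. w y - w' y) = 0"
        using w w' less.prems False by (simp add: is_hom_weight_def sum_subtractf)
      ultimately have "w x - w' x = 0"
        by (rule eq_0_if_sum_left_principal_eq_0[OF less.prems])
      then show ?thesis by simp
    qed
  qed
  then show ?thesis
    using w[unfolded is_hom_weight_def] w'[unfolded is_hom_weight_def]
    by (blast intro: extensionalityI)
qed

text \<open>In terms of \<open>f = 1 - w\<close>, the defining condition says that \<open>f\<close> sums to zero over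
  every nonzero principal left ideal; unlike \<open>w\<close>, such functions can be multiplied over the
  factors of a product ring.\<close>

lemma hom_weight_eq_one_minus:
  assumes zero: "f \<zero> = 1"
    and cong: "\<And>x y. x \<in> carrier R \<Longrightarrow> y \<in> carrier R \<Longrightarrow> left_principal R x = left_principal R y \<Longrightarrow> f x = f y"
    and sum: "\<And>x. x \<in> carrier R \<Longrightarrow> x \<noteq> \<zero> \<Longrightarrow> sum f (left_principal R x) = 0"
    and a: "a \<in> carrier R"
  shows "hom_weight R a = 1 - f a"
proof -
  let ?w = "restrict (\<lambda>a. 1 - f a) (carrier R)"
  have weight: "is_hom_weight R ?w"
    unfolding is_hom_weight_def
  proof (intro conjI ballI impI)
    fix x y assume xy: "x \<in> carrier R" "y \<in> carrier R" "left_principal R x = left_principal R y"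
    show "?w x = ?w y" using xy(1,2) cong[OF xy] by simp
  next
    fix x assume x: "x \<in> carrier R" "x \<noteq> \<zero>"
    have "sum ?w (left_principal R x) = (\<Sum>y\<in>left_principal R x. 1 - f y)"
      by (rule sum.cong) (use x in auto)
    then show "sum ?w (left_principal R x) = of_nat (card (left_principal R x))"
      using sum[OF x] by (simp add: sum_subtractf)
  qed (simp_all add: zero)
  have "hom_weight R = ?w"
    unfolding hom_weight_def
  proof (rule the_equality)
    show "is_hom_weight R ?w" by (rule weight)
    show "w = ?w" if "is_hom_weight R w" for w by (rule hom_weight_unique[OF that weight])
  qed
  then show ?thesis using a by (simp only: restrict_apply')
qed

end

section \<open>Finite local rings with simple socle\<close>

locale finite_local_ring = finite_ring R for R (structure) +
  assumes local_ring: "local_ring R"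
begin

lemma maximal_left_ideal_jrad: "maximal_left_ideal R (jrad R)"
proof -
  obtain M where M: "maximal_left_ideal R M" and "\<And>I. maximal_left_ideal R I \<Longrightarrow> I = M"
    using local_ring unfolding local_ring_def by blast
  then have "{I. maximal_left_ideal R I} = {M}" by blast
  then have "jrad R = carrier R \<inter> M" by (simp add: jrad_def)
  also have "\<dots> = M" using M by (auto simp: maximal_left_ideal_def left_ideal_def)
  finally show ?thesis using M by simp
qed

lemma jrad_proper: "jrad R \<noteq> carrier R"
  using maximal_left_ideal_jrad by (simp add: maximal_left_ideal_def)

lemma proper_left_ideal_subset_jrad:
  assumes "left_ideal R I" "I \<noteq> carrier R"
  shows "I \<subseteq> jrad R"
  using ex_maximal_left_ideal[OF assms] maximal_left_ideal_jrad local_ring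
  unfolding local_ring_def by metis

lemma one_notin_jrad: "\<one> \<notin> jrad R"
  using left_ideal_one_imp_carrier[OF left_ideal_jrad] jrad_proper by blast

lemma one_neq_zero: "\<one> \<noteq> \<zero>"
  using one_notin_jrad left_ideal_zero[OF left_ideal_jrad] by metis

lemma Units_iff_notin_jrad:
  assumes x: "x \<in> carrier R"
  shows "x \<in> Units R \<longleftrightarrow> x \<notin> jrad R"
proof
  assume "x \<in> Units R"
  then show "x \<notin> jrad R"
    using left_ideal_mult[OF left_ideal_jrad, of "inv x" x] one_notin_jrad by auto
next
  assume "x \<notin> jrad R"
  then have "left_principal R x = carrier R"
    using proper_left_ideal_subset_jrad[OF left_ideal_left_principal[OF x]] left_principal_self[OF x]
    by blast
  then have "\<one> \<in> left_principal R x" by simp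
  then obtain y where "y \<in> carrier R" "y \<otimes> x = \<one>" by (rule imageE) auto
  then show "x \<in> Units R" by (rule Units_if_left_inverse(1)[OF x])
qed

lemma jrad_mult_right:
  assumes x: "x \<in> jrad R" and r: "r \<in> carrier R"
  shows "x \<otimes> r \<in> jrad R"
proof (rule ccontr)
  note x_closed = jrad_closed[OF x]
  assume "x \<otimes> r \<notin> jrad R"
  then have u: "x \<otimes> r \<in> Units R" using x_closed r by (simp add: Units_iff_notin_jrad)
  have "x \<otimes> (r \<otimes> inv (x \<otimes> r)) = \<one>"
    using m_assoc[OF x_closed r, of "inv (x \<otimes> r)"] u by simp
  then have "x \<in> Units R"
    using Units_if_left_inverse(2)[of "r \<otimes> inv (x \<otimes> r)" x] x_closed r u by simp
  then show False using x x_closed Units_iff_notin_jrad by blast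
qed

lemma jrad_fixed_imp_zero:
  assumes r: "r \<in> jrad R" and x: "x \<in> carrier R" "r \<otimes> x = x"
  shows "x = \<zero>"
proof -
  note r_closed = jrad_closed[OF r]
  have "(\<one> \<ominus> r) \<oplus> r = \<one>" using r_closed by algebra
  then have "\<one> \<ominus> r \<notin> jrad R"
    using left_ideal_add[OF left_ideal_jrad _ r] one_notin_jrad by metis
  then have u: "\<one> \<ominus> r \<in> Units R" using r_closed by (simp add: Units_iff_notin_jrad)
  have "(\<one> \<ominus> r) \<otimes> x = \<zero>" using r_closed x by (simp add: minus_eq l_distr l_minus r_neg)
  then show ?thesis
    using m_assoc[of "inv (\<one> \<ominus> r)" "\<one> \<ominus> r" x] u Units_closed[OF u] x(1) by simp
qed

lemma minimal_left_ideal_jrad_mult: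
  assumes I: "minimal_left_ideal R I" and x: "x \<in> I" and r: "r \<in> jrad R"
  shows "r \<otimes> x = \<zero>"
proof (rule ccontr)
  assume nonzero: "r \<otimes> x \<noteq> \<zero>"
  have ideal: "left_ideal R I" using I by (simp add: minimal_left_ideal_def)
  note r_closed = jrad_closed[OF r] and x_closed = left_ideal_closed[OF ideal x]
  have "left_principal R (r \<otimes> x) \<subseteq> I"
    using left_ideal_mult[OF ideal r_closed x] by (rule left_principal_subset_left_ideal[OF ideal])
  moreover have "left_principal R (r \<otimes> x) \<noteq> {\<zero>}"
    using nonzero r_closed x_closed by (simp add: left_principal_eq_zero_iff)
  ultimately have "left_principal R (r \<otimes> x) = I"
    using I left_ideal_left_principal[of "r \<otimes> x"] r_closed x_closed unfolding minimal_left_ideal_def by simp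
  then obtain s where s: "s \<in> carrier R" "x = s \<otimes> (r \<otimes> x)" using x by blast
  have "x = \<zero>"
  proof (rule jrad_fixed_imp_zero[OF _ x_closed])
    show "s \<otimes> r \<in> jrad R" by (rule left_ideal_mult[OF left_ideal_jrad s(1) r])
    show "(s \<otimes> r) \<otimes> x = x" using s r_closed x_closed by (simp add: m_assoc)
  qed
  then show False using nonzero r_closed by simp
qed

lemma left_ideal_jrad_annihilated: "left_ideal R {x \<in> carrier R. \<forall>r\<in>jrad R. r \<otimes> x = \<zero>}"
proof (rule left_idealI)
  fix s x assume s: "s \<in> carrier R" and x: "x \<in> {x \<in> carrier R. \<forall>r\<in>jrad R. r \<otimes> x = \<zero>}"
  have "r \<otimes> (s \<otimes> x) = \<zero>" if r: "r \<in> jrad R" for r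
    using s x jrad_closed[OF r] jrad_mult_right[OF r s] by (simp flip: m_assoc)
  then show "s \<otimes> x \<in> {x \<in> carrier R. \<forall>r\<in>jrad R. r \<otimes> x = \<zero>}" using s x by simp
qed (auto simp: r_distr jrad_closed)

lemma minimal_left_ideal_left_principal:
  assumes x: "x \<in> carrier R" "x \<noteq> \<zero>" and ann: "\<forall>r\<in>jrad R. r \<otimes> x = \<zero>"
  shows "minimal_left_ideal R (left_principal R x)"
proof -
  have "K = left_principal R x"
    if K: "left_ideal R K" "K \<subseteq> left_principal R x" "K \<noteq> {\<zero>}" for K
  proof -
    obtain y where y: "y \<in> K" "y \<noteq> \<zero>" using K(1,3) by (rule left_ideal_nonzeroE)
    then obtain s where s: "s \<in> carrier R" "y = s \<otimes> x" using K(2) by blast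
    then have u: "s \<in> Units R" using ann y(2) by (auto simp: Units_iff_notin_jrad)
    then have "inv s \<otimes> y = x" using s x(1) by (simp flip: m_assoc)
    then have "x \<in> K" using left_ideal_mult[OF K(1) _ y(1), of "inv s"] u by simp
    then show ?thesis using left_principal_subset_left_ideal[OF K(1)] K(2) by blast
  qed
  then show ?thesis
    using x left_ideal_left_principal left_principal_eq_zero_iff by (simp add: minimal_left_ideal_def)
qed

lemma lsoc_eq: "lsoc R = {x \<in> carrier R. \<forall>r\<in>jrad R. r \<otimes> x = \<zero>}" (is "_ = ?A")
proof
  show "lsoc R \<subseteq> ?A"
  proof (rule lsoc_least[OF left_ideal_jrad_annihilated])
    fix I assume I: "minimal_left_ideal R I"
    then have "I \<subseteq> carrier R" by (simp add: minimal_left_ideal_def left_ideal_def)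
    then show "I \<subseteq> ?A" using minimal_left_ideal_jrad_mult[OF I] by blast
  qed
  show "?A \<subseteq> lsoc R"
  proof
    fix x assume x: "x \<in> ?A"
    show "x \<in> lsoc R"
    proof (cases "x = \<zero>")
      case False
      then have "left_principal R x \<subseteq> lsoc R"
        using x by (intro minimal_left_ideal_subset_lsoc minimal_left_ideal_left_principal) auto
      then show ?thesis using x left_principal_self by blast
    qed (simp add: left_ideal_zero[OF left_ideal_lsoc])
  qed
qed

lemma lsoc_mult_right: "x \<in> lsoc R \<Longrightarrow> r \<in> carrier R \<Longrightarrow> x \<otimes> r \<in> lsoc R"
  using jrad_closed[where R = R] by (simp add: lsoc_eq flip: m_assoc)

lemma left_annihilator_lsoc:
  assumes x: "x \<in> lsoc R" "x \<noteq> \<zero>"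
  shows "left_annihilator R x = jrad R"
proof
  have x_closed: "x \<in> carrier R" using x by (simp add: lsoc_eq)
  have "\<one> \<notin> left_annihilator R x" using x_closed x(2) by (simp add: left_annihilator_def)
  then show "left_annihilator R x \<subseteq> jrad R"
    using proper_left_ideal_subset_jrad[OF left_ideal_left_annihilator[OF x_closed]] by blast
  show "jrad R \<subseteq> left_annihilator R x"
    using x(1) jrad_closed by (auto simp: lsoc_eq left_annihilator_def)
qed

lemma card_rcosets_jrad: "card (a_rcosets (jrad R)) * card (jrad R) = card (carrier R)"
  using a_lagrange[OF finite_carrier left_ideal_additive_subgroup[OF left_ideal_jrad]]
  by (simp add: order_def)

lemma card_left_principal_lsoc:
  assumes "x \<in> lsoc R" "x \<noteq> \<zero>"
  shows "card (left_principal R x) = card (a_rcosets (jrad R))"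
proof -
  have "card (left_principal R x) * card (jrad R) = card (a_rcosets (jrad R)) * card (jrad R)"
    using card_left_principal_mult_left_annihilator[of x] card_rcosets_jrad
      left_annihilator_lsoc[OF assms] left_ideal_closed[OF left_ideal_lsoc assms(1)] by simp
  then show ?thesis using card_left_ideal_pos[OF left_ideal_jrad] by simp
qed

lemma lsoc_neq_zero: "lsoc R \<noteq> {\<zero>}"
proof -
  have "carrier R \<noteq> {\<zero>}" using one_neq_zero one_closed by blast
  then obtain K where K: "minimal_left_ideal R K"
    using ex_minimal_left_ideal[OF left_ideal_carrier] by blast
  then show ?thesis
    using minimal_left_ideal_subset_lsoc[OF K] left_ideal_zero[of R K]
    by (auto simp: minimal_left_ideal_def)
qed

lemma card_lsoc_ge_2: "card (lsoc R) \<ge> 2"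
proof -
  obtain x where "x \<in> lsoc R" "x \<noteq> \<zero>" using left_ideal_lsoc lsoc_neq_zero by (rule left_ideal_nonzeroE)
  then have "card {x, \<zero>} \<le> card (lsoc R)"
    using left_ideal_zero[OF left_ideal_lsoc] by (intro card_mono finite_left_ideal left_ideal_lsoc) auto
  then show ?thesis using \<open>x \<noteq> \<zero>\<close> by simp
qed

end

locale simple_socle_ring = finite_local_ring R for R (structure) +
  assumes card_lsoc_eq: "card (lsoc R) = card (a_rcosets (jrad R))"
begin

lemma card_carrier: "card (carrier R) = card (jrad R) * card (lsoc R)"
  using card_rcosets_jrad by (simp add: card_lsoc_eq mult.commute)

lemma left_principal_lsoc:
  assumes x: "x \<in> lsoc R" "x \<noteq> \<zero>"
  shows "left_principal R x = lsoc R"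
  by (rule card_subset_eq[OF finite_left_ideal[OF left_ideal_lsoc]
        left_principal_subset_left_ideal[OF left_ideal_lsoc x(1)]])
    (simp add: card_left_principal_lsoc[OF x] card_lsoc_eq)

lemma lsoc_subset_left_ideal:
  assumes "left_ideal R I" "I \<noteq> {\<zero>}"
  shows "lsoc R \<subseteq> I"
proof -
  obtain K where K: "minimal_left_ideal R K" "K \<subseteq> I"
    using ex_minimal_left_ideal[OF assms] .
  then have ideal: "left_ideal R K" "K \<noteq> {\<zero>}" by (auto simp: minimal_left_ideal_def)
  then obtain x where x: "x \<in> K" "x \<noteq> \<zero>" by (rule left_ideal_nonzeroE)
  then have "left_principal R x = lsoc R"
    using minimal_left_ideal_subset_lsoc[OF K(1)] by (intro left_principal_lsoc) auto
  then show ?thesis using left_principal_subset_left_ideal[OF ideal(1) x(1)] K(2) by simp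
qed

lemma lsoc_mult_jrad:
  assumes x: "x \<in> lsoc R" and r: "r \<in> jrad R"
  shows "x \<otimes> r = \<zero>"
proof -
  note r_closed = jrad_closed[OF r]
  have "left_principal R r \<noteq> carrier R"
    using left_principal_subset_left_ideal[OF left_ideal_jrad r] one_notin_jrad by auto
  then have "left_annihilator R r \<noteq> {\<zero>}"
    using left_principal_eq_carrier[OF r_closed] by blast
  then have "x \<in> left_annihilator R r"
    using lsoc_subset_left_ideal[OF left_ideal_left_annihilator[OF r_closed]] x by blast
  then show ?thesis by (simp add: left_annihilator_def)
qed

lemma lsoc_mult_eq_zero_iff:
  assumes x: "x \<in> carrier R"
  shows "(\<forall>y\<in>lsoc R. y \<otimes> x = \<zero>) \<longleftrightarrow> x \<in> jrad R"
    and "(\<forall>y\<in>lsoc R. x \<otimes> y = \<zero>) \<longleftrightarrow> x \<in> jrad R"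
proof -
  obtain z where z: "z \<in> lsoc R" "z \<noteq> \<zero>"
    using left_ideal_lsoc lsoc_neq_zero by (rule left_ideal_nonzeroE)
  note z_closed = left_ideal_closed[OF left_ideal_lsoc z(1)]
  have nonzero: "z \<otimes> x \<noteq> \<zero>" "x \<otimes> z \<noteq> \<zero>" if "x \<notin> jrad R"
  proof -
    have u: "x \<in> Units R" using that x Units_iff_notin_jrad by blast
    have "z \<otimes> x \<otimes> inv x = z" using u x z_closed by (simp add: m_assoc)
    moreover have "inv x \<otimes> (x \<otimes> z) = z" using u x z_closed by (simp flip: m_assoc)
    ultimately show "z \<otimes> x \<noteq> \<zero>" "x \<otimes> z \<noteq> \<zero>" using z(2) u by auto
  qed
  have zero: "y \<otimes> x = \<zero>" "x \<otimes> y = \<zero>" if "x \<in> jrad R" "y \<in> lsoc R" for y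
    using that lsoc_mult_jrad[OF that(2,1)] unfolding lsoc_eq by blast+
  show "(\<forall>y\<in>lsoc R. y \<otimes> x = \<zero>) \<longleftrightarrow> x \<in> jrad R"
    using nonzero(1) zero(1) z(1) by blast
  show "(\<forall>y\<in>lsoc R. x \<otimes> y = \<zero>) \<longleftrightarrow> x \<in> jrad R"
    using nonzero(2) zero(2) z(1) by blast
qed

end

section \<open>Nondegenerate characters\<close>

locale nondegenerate_character = finite_ring R for R (structure) +
  fixes \<chi> :: "'a \<Rightarrow> complex"
  assumes character_zero: "\<chi> \<zero> = 1"
    and character_add: "x \<in> carrier R \<Longrightarrow> y \<in> carrier R \<Longrightarrow> \<chi> (x \<oplus> y) = \<chi> x * \<chi> y"
    and left_nondegenerate: "x \<in> carrier R \<Longrightarrow> x \<noteq> \<zero> \<Longrightarrow> \<exists>r\<in>carrier R. \<chi> (r \<otimes> x) \<noteq> 1"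

lemma (in finite_ring) nondegenerate_character_if_generating:
  assumes gen: "generating_char R \<chi>"
  shows "nondegenerate_character R \<chi>"
proof unfold_locales
  show add: "\<chi> (x \<oplus> y) = \<chi> x * \<chi> y" if "x \<in> carrier R" "y \<in> carrier R" for x y
    using gen that unfolding generating_char_def add_chars_def by blast
  have "\<chi> \<zero> \<noteq> 0" using gen unfolding generating_char_def add_chars_def by blast
  then show zero: "\<chi> \<zero> = 1" using add[of \<zero> \<zero>] by simp
  fix x assume x: "x \<in> carrier R" "x \<noteq> \<zero>"
  show "\<exists>r\<in>carrier R. \<chi> (r \<otimes> x) \<noteq> 1"
  proof (rule ccontr)
    assume "\<not> ?thesis"
    then have "restrict (\<lambda>y. \<chi> (y \<otimes> x)) (carrier R) = restrict (\<lambda>y. \<chi> (y \<otimes> \<zero>)) (carrier R)"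
      by (intro restrict_ext) (auto simp: zero)
    then show False
      using gen x inj_onD[of "\<lambda>r. restrict (\<lambda>y. \<chi> (y \<otimes> r)) (carrier R)" "carrier R" x \<zero>]
      by (auto simp: generating_char_def bij_betw_def)
  qed
qed

context nondegenerate_character
begin

lemma sum_character_left_mult:
  assumes I: "left_ideal R I" and x: "x \<in> carrier R"
  shows "(\<Sum>y\<in>I. \<chi> (y \<otimes> x)) = (if \<forall>y\<in>I. y \<otimes> x = \<zero> then of_nat (card I) else 0)"
proof -
  have "(\<Sum>y\<in>I. \<chi> (y \<otimes> x)) = (if \<forall>y\<in>I. \<chi> (y \<otimes> x) = 1 then of_nat (card I) else 0)"
    using left_ideal_closed[OF I] x
    by (intro sum_multiplicative_over_subgroup left_ideal_additive_subgroup finite_left_ideal I)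
      (simp add: l_distr character_add)
  moreover have "(\<forall>y\<in>I. \<chi> (y \<otimes> x) = 1) \<longleftrightarrow> (\<forall>y\<in>I. y \<otimes> x = \<zero>)"
  proof safe
    fix y assume one: "\<forall>y\<in>I. \<chi> (y \<otimes> x) = 1" and y: "y \<in> I"
    have "\<chi> (r \<otimes> (y \<otimes> x)) = 1" if r: "r \<in> carrier R" for r
      using one left_ideal_mult[OF I r y] left_ideal_closed[OF I y] r x by (simp flip: m_assoc)
    then show "y \<otimes> x = \<zero>" using left_nondegenerate left_ideal_closed[OF I y] x by blast
  qed (simp add: character_zero)
  ultimately show ?thesis by simp
qed

text \<open>Counting the sum of \<open>\<chi> (a b)\<close> over all pairs in two ways shows that the left and the right
  kernel of the pairing have the same size.\<close>

lemma right_nondegenerate: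
  assumes x: "x \<in> carrier R" "x \<noteq> \<zero>"
  shows "\<exists>r\<in>carrier R. \<chi> (x \<otimes> r) \<noteq> 1"
proof -
  let ?N = "of_nat (card (carrier R)) :: complex"
  define K where "K = {a \<in> carrier R. \<forall>b\<in>carrier R. \<chi> (a \<otimes> b) = 1}"
  have row: "(\<Sum>b\<in>carrier R. \<chi> (a \<otimes> b)) = (if a \<in> K then ?N else 0)" if a: "a \<in> carrier R" for a
    using a sum_multiplicative_over_subgroup[OF left_ideal_additive_subgroup[OF left_ideal_carrier]
        finite_carrier, of "\<lambda>b. \<chi> (a \<otimes> b)"] by (simp add: K_def r_distr character_add)
  have column: "(\<Sum>a\<in>carrier R. \<chi> (a \<otimes> b)) = (if b = \<zero> then ?N else 0)" if b: "b \<in> carrier R" for b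
    using sum_character_left_mult[OF left_ideal_carrier b] by (simp only: carrier_mult_eq_zero_iff[OF b])
  have "of_nat (card K) * ?N = (\<Sum>a\<in>carrier R. if a \<in> K then ?N else 0)"
    using finite_carrier by (simp add: K_def sum.inter_filter[symmetric])
  also have "\<dots> = (\<Sum>a\<in>carrier R. \<Sum>b\<in>carrier R. \<chi> (a \<otimes> b))"
    by (rule sum.cong[OF refl row, symmetric])
  also have "\<dots> = (\<Sum>b\<in>carrier R. \<Sum>a\<in>carrier R. \<chi> (a \<otimes> b))" by (rule sum.swap)
  also have "\<dots> = (\<Sum>b\<in>carrier R. if b = \<zero> then ?N else 0)"
    by (rule sum.cong[OF refl column])
  also have "\<dots> = ?N" using finite_carrier by simp
  finally have "card K = 1" using card_left_ideal_pos[OF left_ideal_carrier] by simp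
  moreover have "\<zero> \<in> K" by (simp add: K_def character_zero)
  ultimately have "x \<notin> K" using x(2) by (auto simp: card_1_singleton_iff)
  then show ?thesis using x(1) by (simp add: K_def)
qed

lemma sum_character_right_mult:
  assumes I: "left_ideal R I" and right: "\<And>y r. y \<in> I \<Longrightarrow> r \<in> carrier R \<Longrightarrow> y \<otimes> r \<in> I"
    and x: "x \<in> carrier R"
  shows "(\<Sum>y\<in>I. \<chi> (x \<otimes> y)) = (if \<forall>y\<in>I. x \<otimes> y = \<zero> then of_nat (card I) else 0)"
proof -
  have "(\<Sum>y\<in>I. \<chi> (x \<otimes> y)) = (if \<forall>y\<in>I. \<chi> (x \<otimes> y) = 1 then of_nat (card I) else 0)"
    using left_ideal_closed[OF I] x
    by (intro sum_multiplicative_over_subgroup left_ideal_additive_subgroup finite_left_ideal I)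
      (simp add: r_distr character_add)
  moreover have "(\<forall>y\<in>I. \<chi> (x \<otimes> y) = 1) \<longleftrightarrow> (\<forall>y\<in>I. x \<otimes> y = \<zero>)"
  proof safe
    fix y assume one: "\<forall>y\<in>I. \<chi> (x \<otimes> y) = 1" and y: "y \<in> I"
    have "\<chi> ((x \<otimes> y) \<otimes> r) = 1" if r: "r \<in> carrier R" for r
      using one right[OF y r] left_ideal_closed[OF I y] r x by (simp add: m_assoc)
    then show "x \<otimes> y = \<zero>" using right_nondegenerate left_ideal_closed[OF I y] x by blast
  qed (simp add: character_zero)
  ultimately show ?thesis by simp
qed

lemma sum_character_carrier:
  assumes x: "x \<in> carrier R"
  shows "(\<Sum>y\<in>carrier R. \<chi> (y \<otimes> x)) = (if x = \<zero> then of_nat (card (carrier R)) else 0)"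
    and "(\<Sum>y\<in>carrier R. \<chi> (x \<otimes> y)) = (if x = \<zero> then of_nat (card (carrier R)) else 0)"
  using sum_character_left_mult[OF left_ideal_carrier x]
    sum_character_right_mult[OF left_ideal_carrier _ x]
  by (simp_all only: carrier_mult_eq_zero_iff[OF x] m_closed)

end

locale simple_socle_character = simple_socle_ring R + nondegenerate_character R \<chi>
  for R (structure) and \<chi>
begin

lemma sum_character_lsoc:
  assumes x: "x \<in> carrier R"
  shows "(\<Sum>y\<in>lsoc R - {\<zero>}. \<chi> (y \<otimes> x)) = (if x \<in> jrad R then of_nat (card (lsoc R)) - 1 else - 1)"
    and "(\<Sum>y\<in>lsoc R - {\<zero>}. \<chi> (x \<otimes> y)) = (if x \<in> jrad R then of_nat (card (lsoc R)) - 1 else - 1)"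
proof -
  have remove: "(\<Sum>y\<in>lsoc R - {\<zero>}. g y) = (\<Sum>y\<in>lsoc R. g y) - g \<zero>" for g :: "'a \<Rightarrow> complex"
    using finite_left_ideal[OF left_ideal_lsoc] left_ideal_zero[OF left_ideal_lsoc]
    by (simp add: sum_diff1)
  show "(\<Sum>y\<in>lsoc R - {\<zero>}. \<chi> (y \<otimes> x)) = (if x \<in> jrad R then of_nat (card (lsoc R)) - 1 else - 1)"
    using sum_character_left_mult[OF left_ideal_lsoc x]
    by (simp add: remove character_zero x lsoc_mult_eq_zero_iff(1))
  show "(\<Sum>y\<in>lsoc R - {\<zero>}. \<chi> (x \<otimes> y)) = (if x \<in> jrad R then of_nat (card (lsoc R)) - 1 else - 1)"
    using sum_character_right_mult[OF left_ideal_lsoc lsoc_mult_right x]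
    by (simp add: remove character_zero x lsoc_mult_eq_zero_iff(2))
qed

lemma sum_character_jrad:
  assumes x: "x \<in> carrier R"
  shows "(\<Sum>y\<in>jrad R. \<chi> (y \<otimes> x)) = (if x \<in> lsoc R then of_nat (card (jrad R)) else 0)"
  using sum_character_left_mult[OF left_ideal_jrad x] x by (simp add: lsoc_eq)

lemma sum_character_nonradical:
  assumes x: "x \<in> carrier R"
  shows "(\<Sum>y\<in>carrier R - jrad R. \<chi> (y \<otimes> x))
    = (if x = \<zero> then of_nat (card (lsoc R)) - 1 else - 1) * (\<Sum>y\<in>jrad R. \<chi> (y \<otimes> x))"
proof -
  have "(\<Sum>y\<in>carrier R - jrad R. \<chi> (y \<otimes> x)) = (\<Sum>y\<in>carrier R. \<chi> (y \<otimes> x)) - (\<Sum>y\<in>jrad R. \<chi> (y \<otimes> x))"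
    using jrad_closed by (intro sum_diff finite_carrier) auto
  also have "\<dots> = (if x = \<zero> then of_nat (card (lsoc R)) - 1 else - 1) * (\<Sum>y\<in>jrad R. \<chi> (y \<otimes> x))"
    unfolding sum_character_carrier(1)[OF x] sum_character_jrad[OF x]
    using left_ideal_zero[OF left_ideal_lsoc] by (auto simp: card_carrier algebra_simps)
  finally show ?thesis .
qed

end

section \<open>Sums over boxes and Krawtchouk values\<close>

abbreviation idx :: "nat \<Rightarrow> (nat \<Rightarrow> nat) \<Rightarrow> (nat \<times> nat) set" where
  "idx t n \<equiv> {(i, j). in_idx t n i j}"

lemma idx_eq_Sigma: "idx t n = (SIGMA i:{..<t}. {..<n i})"
  by (auto simp: in_idx_def)

lemma finite_idx: "finite (idx t n)"
  by (simp add: idx_eq_Sigma)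

lemma prod_idx_cong:
  "(\<And>i j. in_idx t n i j \<Longrightarrow> f i j = g i j) \<Longrightarrow> (\<Prod>(i, j)\<in>idx t n. f i j) = (\<Prod>(i, j)\<in>idx t n. g i j)"
  by (auto intro: prod.cong)

lemma prod_idx_eq_0_iff:
  fixes f :: "nat \<Rightarrow> nat \<Rightarrow> 'r :: semidom"
  shows "(\<Prod>(i, j)\<in>idx t n. f i j) = 0 \<longleftrightarrow> (\<exists>i j. in_idx t n i j \<and> f i j = 0)"
  by (auto simp: prod_zero_iff[OF finite_idx])

definition box :: "nat \<Rightarrow> (nat \<Rightarrow> nat) \<Rightarrow> (nat \<Rightarrow> nat \<Rightarrow> 'c set) \<Rightarrow> (nat \<Rightarrow> nat \<Rightarrow> 'c) set" where
  "box t n B = {a. \<forall>i j. (in_idx t n i j \<longrightarrow> a i j \<in> B i j) \<and> (\<not> in_idx t n i j \<longrightarrow> a i j = undefined)}"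

lemma box_component: "a \<in> box t n B \<Longrightarrow> in_idx t n i j \<Longrightarrow> a i j \<in> B i j"
  by (simp add: box_def)

lemma box_mono: "(\<And>i j. in_idx t n i j \<Longrightarrow> B i j \<subseteq> C i j) \<Longrightarrow> box t n B \<subseteq> box t n C"
  unfolding box_def by blast

lemma box_eq_curry_image: "box t n B = curry ` (\<Pi>\<^sub>E (i, j)\<in>idx t n. B i j)"
proof (intro equalityI subsetI)
  fix a assume a: "a \<in> box t n B"
  have "case_prod a \<in> (\<Pi>\<^sub>E (i, j)\<in>idx t n. B i j)"
    using a by (auto simp: box_def PiE_iff extensional_def split: if_splits)
  then show "a \<in> curry ` (\<Pi>\<^sub>E (i, j)\<in>idx t n. B i j)"
    by (rule rev_image_eqI) simp
qed (auto simp: box_def PiE_iff extensional_def)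

lemma finite_box:
  assumes "\<And>i j. in_idx t n i j \<Longrightarrow> finite (B i j)"
  shows "finite (box t n B)"
  unfolding box_eq_curry_image using assms by (intro finite_imageI finite_PiE finite_idx) auto

lemma sum_box_prod:
  fixes g :: "nat \<Rightarrow> nat \<Rightarrow> 'c \<Rightarrow> 'r :: comm_semiring_1"
  assumes "\<And>i j. in_idx t n i j \<Longrightarrow> finite (B i j)"
  shows "(\<Sum>a\<in>box t n B. \<Prod>(i, j)\<in>idx t n. g i j (a i j)) = (\<Prod>(i, j)\<in>idx t n. \<Sum>b\<in>B i j. g i j b)"
proof -
  have "inj_on curry (\<Pi>\<^sub>E (i, j)\<in>idx t n. B i j)"
    by (rule inj_on_inverseI[of _ case_prod]) simp
  then have "(\<Sum>a\<in>box t n B. \<Prod>(i, j)\<in>idx t n. g i j (a i j))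
      = (\<Sum>f\<in>(\<Pi>\<^sub>E (i, j)\<in>idx t n. B i j). \<Prod>p\<in>idx t n. case_prod g p (f p))"
    unfolding box_eq_curry_image by (simp add: sum.reindex case_prod_unfold)
  also have "\<dots> = (\<Prod>p\<in>idx t n. \<Sum>b\<in>case_prod B p. case_prod g p b)"
    using assms by (intro prod_sum_PiE[symmetric] finite_idx) auto
  finally show ?thesis by (simp add: case_prod_unfold)
qed

definition weight_outside :: "(nat \<Rightarrow> nat) \<Rightarrow> (nat \<Rightarrow> nat \<Rightarrow> 'c set) \<Rightarrow> (nat \<Rightarrow> nat \<Rightarrow> 'c) \<Rightarrow> nat \<Rightarrow> nat" where
  "weight_outside n Z a i = card {j. j < n i \<and> a i j \<notin> Z i j}"

definition weight_block :: "nat \<Rightarrow> (nat \<Rightarrow> nat) \<Rightarrow> (nat \<Rightarrow> nat \<Rightarrow> 'c set) \<Rightarrow> (nat \<Rightarrow> nat \<Rightarrow> 'c set) \<Rightarrow> (nat \<Rightarrow> nat)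
    \<Rightarrow> (nat \<Rightarrow> nat \<Rightarrow> 'c) set" where
  "weight_block t n B Z m = {a \<in> box t n B. \<forall>i<t. weight_outside n Z a i = m i}"

lemma weight_outside_le: "weight_outside n Z a i \<le> n i"
  unfolding weight_outside_def using card_mono[of "{..<n i}" "{j. j < n i \<and> a i j \<notin> Z i j}"] by auto

lemma in_M_weight_outside: "in_M t n (weight_outside n Z a)"
  by (simp add: in_M_def weight_outside_le)

lemma in_M_if_weight_block: "a \<in> weight_block t n B Z m \<Longrightarrow> in_M t n m"
  by (simp add: weight_block_def in_M_def) (metis weight_outside_le)

lemma weight_outside_eq_0_iff:
  "(\<forall>i<t. weight_outside n Z a i = 0) \<longleftrightarrow> (\<forall>i j. in_idx t n i j \<longrightarrow> a i j \<in> Z i j)"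
  by (auto simp: weight_outside_def in_idx_def)

lemma sum_box_eq_if_sum_weight_blocks_eq:
  fixes f g :: "(nat \<Rightarrow> nat \<Rightarrow> 'c) \<Rightarrow> 'r :: comm_monoid_add"
  assumes finite: "finite (box t n B)"
    and blocks: "\<And>m. sum f (weight_block t n B Z m) = sum g (weight_block t n B Z m)"
  shows "sum f (box t n B) = sum g (box t n B)"
proof -
  define w where "w a = restrict (weight_outside n Z a) {..<t}" for a :: "nat \<Rightarrow> nat \<Rightarrow> 'c"
  have "{b \<in> box t n B. w b = w a} = weight_block t n B Z (weight_outside n Z a)" for a
    by (auto simp: w_def weight_block_def restrict_def fun_eq_iff)
  then have "sum f {b \<in> box t n B. w b = y} = sum g {b \<in> box t n B. w b = y}" if "y \<in> w ` box t n B" for y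
    using that blocks by auto
  then show ?thesis unfolding sum.image_gen[OF finite, of _ w] by (rule sum.cong[OF refl])
qed

definition supports :: "nat \<Rightarrow> (nat \<Rightarrow> nat) \<Rightarrow> (nat \<Rightarrow> nat) \<Rightarrow> (nat \<times> nat) set set" where
  "supports t n m = {U. U \<subseteq> idx t n \<and> (\<forall>i<t. card {j. (i, j) \<in> U} = m i)}"

lemma finite_supports: "finite (supports t n m)"
  by (rule finite_subset[of _ "Pow (idx t n)"]) (auto simp: supports_def finite_idx)

lemma finite_support_row: "U \<subseteq> idx t n \<Longrightarrow> finite {j. (i, j) \<in> U}"
  by (rule finite_subset[of _ "{..<n i}"]) (auto simp: in_idx_def)

definition support_box :: "nat \<Rightarrow> (nat \<Rightarrow> nat) \<Rightarrow> (nat \<Rightarrow> nat \<Rightarrow> 'c set) \<Rightarrow> (nat \<Rightarrow> nat \<Rightarrow> 'c set) \<Rightarrow> (nat \<times> nat) set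
    \<Rightarrow> (nat \<Rightarrow> nat \<Rightarrow> 'c) set" where
  "support_box t n B Z U = box t n (\<lambda>i j. if (i, j) \<in> U then B i j - Z i j else Z i j)"

lemma support_box_notin_iff: "a \<in> support_box t n B Z U \<Longrightarrow> in_idx t n i j \<Longrightarrow> a i j \<notin> Z i j \<longleftrightarrow> (i, j) \<in> U"
  unfolding support_box_def by (drule box_component) (auto split: if_splits)

lemma support_boxes_disjoint:
  assumes "U \<subseteq> idx t n" "V \<subseteq> idx t n" "U \<noteq> V"
  shows "support_box t n B Z U \<inter> support_box t n B Z V = {}"
proof (rule ccontr)
  assume "support_box t n B Z U \<inter> support_box t n B Z V \<noteq> {}"
  then obtain a where a: "a \<in> support_box t n B Z U" "a \<in> support_box t n B Z V" by blast
  have "(i, j) \<in> U \<longleftrightarrow> (i, j) \<in> V" if "in_idx t n i j" for i j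
    using support_box_notin_iff[OF a(1) that] support_box_notin_iff[OF a(2) that] by simp
  then show False using assms by auto
qed

lemma weight_block_eq_UN_support_box:
  assumes Z: "\<And>i j. in_idx t n i j \<Longrightarrow> Z i j \<subseteq> B i j"
  shows "weight_block t n B Z m = (\<Union>U\<in>supports t n m. support_box t n B Z U)"
proof (intro equalityI subsetI)
  fix a assume a: "a \<in> weight_block t n B Z m"
  let ?U = "{(i, j). in_idx t n i j \<and> a i j \<notin> Z i j}"
  have "{j. (i, j) \<in> ?U} = {j. j < n i \<and> a i j \<notin> Z i j}" if "i < t" for i
    using that by (auto simp: in_idx_def)
  then have "?U \<in> supports t n m"
    using a by (auto simp: supports_def weight_block_def weight_outside_def)
  moreover have "a \<in> support_box t n B Z ?U"
    using a by (simp add: weight_block_def support_box_def box_def)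
  ultimately show "a \<in> (\<Union>U\<in>supports t n m. support_box t n B Z U)" by blast
next
  fix a assume "a \<in> (\<Union>U\<in>supports t n m. support_box t n B Z U)"
  then obtain U where U: "U \<in> supports t n m" and a: "a \<in> support_box t n B Z U" by blast
  have "{j. j < n i \<and> a i j \<notin> Z i j} = {j. (i, j) \<in> U}" if "i < t" for i
    using support_box_notin_iff[OF a, of i] U that by (auto simp: in_idx_def supports_def)
  then have "\<forall>i<t. weight_outside n Z a i = m i"
    using U by (simp add: weight_outside_def supports_def)
  moreover have "a \<in> box t n B"
    by (rule subsetD[OF box_mono a[unfolded support_box_def]]) (use Z in auto)
  ultimately show "a \<in> weight_block t n B Z m" by (simp add: weight_block_def)
qed

lemma sum_support_box:
  fixes g :: "nat \<Rightarrow> nat \<Rightarrow> 'c \<Rightarrow> 'r :: comm_semiring_1"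
  assumes Z: "\<And>i j. in_idx t n i j \<Longrightarrow> Z i j \<subseteq> B i j"
    and finite: "\<And>i j. in_idx t n i j \<Longrightarrow> finite (B i j)"
    and ratio: "\<And>i j. in_idx t n i j \<Longrightarrow> (\<Sum>b\<in>B i j - Z i j. g i j b) = c i j * (\<Sum>b\<in>Z i j. g i j b)"
    and U: "U \<subseteq> idx t n"
  shows "(\<Sum>a\<in>support_box t n B Z U. \<Prod>(i, j)\<in>idx t n. g i j (a i j))
    = (\<Prod>(i, j)\<in>idx t n. \<Sum>b\<in>Z i j. g i j b) * (\<Prod>(i, j)\<in>U. c i j)"
proof -
  let ?C = "\<lambda>i j. if (i, j) \<in> U then B i j - Z i j else Z i j"
  let ?z = "\<lambda>i j. \<Sum>b\<in>Z i j. g i j b"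
  have "finite (?C i j)" if "in_idx t n i j" for i j
    using finite[OF that] Z[OF that] by (auto intro: finite_subset)
  then have "(\<Sum>a\<in>support_box t n B Z U. \<Prod>(i, j)\<in>idx t n. g i j (a i j))
      = (\<Prod>(i, j)\<in>idx t n. \<Sum>b\<in>?C i j. g i j b)"
    unfolding support_box_def by (rule sum_box_prod)
  also have "\<dots> = (\<Prod>(i, j)\<in>idx t n. ?z i j * (if (i, j) \<in> U then c i j else 1))"
    by (rule prod_idx_cong) (simp add: ratio mult.commute)
  also have "\<dots> = (\<Prod>(i, j)\<in>idx t n. ?z i j) * (\<Prod>p\<in>idx t n. if p \<in> U then c (fst p) (snd p) else 1)"
    by (simp add: prod.distrib case_prod_unfold)
  also have "(\<Prod>p\<in>idx t n. if p \<in> U then c (fst p) (snd p) else 1) = (\<Prod>p\<in>idx t n \<inter> U. c (fst p) (snd p))"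
    by (rule prod.inter_restrict[OF finite_idx, symmetric])
  also have "idx t n \<inter> U = U" using U by blast
  finally show ?thesis by (simp add: case_prod_unfold)
qed

text \<open>If \<open>c i\<close> takes the value \<open>-1\<close> at \<open>k\<^sub>i\<close> places and \<open>q\<^sub>i - 1\<close> elsewhere, then this is the
  product over \<open>i\<close> of the values at \<open>k\<^sub>i\<close> of the Krawtchouk polynomials of degree \<open>m\<^sub>i\<close>.\<close>

definition krawtchouk :: "nat \<Rightarrow> (nat \<Rightarrow> nat) \<Rightarrow> (nat \<Rightarrow> nat) \<Rightarrow> (nat \<Rightarrow> nat \<Rightarrow> 'r) \<Rightarrow> 'r :: comm_semiring_1" where
  "krawtchouk t n m c = (\<Sum>U\<in>supports t n m. \<Prod>(i, j)\<in>U. c i j)"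

lemma sum_weight_block:
  fixes g :: "nat \<Rightarrow> nat \<Rightarrow> 'c \<Rightarrow> 'r :: comm_semiring_1"
  assumes Z: "\<And>i j. in_idx t n i j \<Longrightarrow> Z i j \<subseteq> B i j"
    and finite: "\<And>i j. in_idx t n i j \<Longrightarrow> finite (B i j)"
    and ratio: "\<And>i j. in_idx t n i j \<Longrightarrow> (\<Sum>b\<in>B i j - Z i j. g i j b) = c i j * (\<Sum>b\<in>Z i j. g i j b)"
  shows "(\<Sum>a\<in>weight_block t n B Z m. \<Prod>(i, j)\<in>idx t n. g i j (a i j))
    = (\<Prod>(i, j)\<in>idx t n. \<Sum>b\<in>Z i j. g i j b) * krawtchouk t n m c"
proof -
  let ?g = "\<lambda>a. \<Prod>(i, j)\<in>idx t n. g i j (a i j)"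
  let ?z = "\<Prod>(i, j)\<in>idx t n. \<Sum>b\<in>Z i j. g i j b"
  have subset: "U \<subseteq> idx t n" if "U \<in> supports t n m" for U
    using that by (simp add: supports_def)
  have "sum ?g (weight_block t n B Z m) = sum ?g (\<Union>U\<in>supports t n m. support_box t n B Z U)"
    using weight_block_eq_UN_support_box[OF Z] by simp
  also have "\<dots> = (\<Sum>U\<in>supports t n m. sum ?g (support_box t n B Z U))"
  proof (rule sum.UNION_disjoint[OF finite_supports])
    show "\<forall>U\<in>supports t n m. finite (support_box t n B Z U)"
      unfolding support_box_def using finite finite_subset[OF Z] by (auto intro!: finite_box)
  qed (use support_boxes_disjoint subset in blast)
  also have "\<dots> = (\<Sum>U\<in>supports t n m. ?z * (\<Prod>(i, j)\<in>U. c i j))"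
    using sum_support_box[OF Z finite ratio subset] by (intro sum.cong refl)
  finally show ?thesis by (simp add: krawtchouk_def sum_distrib_left)
qed

lemma image_row_permutation_supports:
  assumes f: "\<And>i. i < t \<Longrightarrow> f i permutes {..<n i}"
  defines "\<Phi> \<equiv> \<lambda>(i, j). (i, f i j)"
  shows "inj_on \<Phi> (idx t n)" and "bij_betw (image \<Phi>) (supports t n m) (supports t n m)"
proof -
  show inj: "inj_on \<Phi> (idx t n)"
    using permutes_inj[OF f] by (auto simp: \<Phi>_def in_idx_def inj_on_def dest: injD)
  have image: "\<Phi> ` U \<in> supports t n m" if U: "U \<in> supports t n m" for U
  proof -
    have "card {j. (i, j) \<in> \<Phi> ` U} = card {j. (i, j) \<in> U}" if i: "i < t" for i
    proof -
      have "{j. (i, j) \<in> \<Phi> ` U} = f i ` {j. (i, j) \<in> U}" by (force simp: \<Phi>_def)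
      then show ?thesis by (simp add: card_image inj_on_subset[OF permutes_inj[OF f[OF i]]])
    qed
    moreover have "f i j < n i" if "i < t" "j < n i" for i j
      using permutes_in_image[OF f[OF that(1)], of j] that(2) by simp
    then have "\<Phi> ` U \<subseteq> idx t n"
      using U by (auto simp: supports_def \<Phi>_def in_idx_def)
    ultimately show ?thesis using U by (simp add: supports_def)
  qed
  have inj_image: "inj_on (image \<Phi>) (supports t n m)"
    by (rule inj_on_subset[OF inj_on_image_Pow[OF inj]]) (auto simp: supports_def)
  have "image \<Phi> ` supports t n m = supports t n m"
    using image by (intro endo_inj_surj[OF finite_supports _ inj_image] image_subsetI)
  then show "bij_betw (image \<Phi>) (supports t n m) (supports t n m)"
    using inj_image by (simp add: bij_betw_def)
qed

lemma krawtchouk_cong: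
  assumes rows: "\<And>i. i < t \<Longrightarrow> image_mset (c i) (mset_set {..<n i}) = image_mset (c' i) (mset_set {..<n i})"
  shows "krawtchouk t n m c = krawtchouk t n m c'"
proof -
  have "\<exists>f. f permutes {..<n i} \<and> (\<forall>j<n i. c i j = c' i (f j))" if "i < t" for i
    using image_mset_eq_implies_permutes[OF finite_lessThan rows[OF that]] by (metis lessThan_iff)
  then obtain f where f: "\<And>i. i < t \<Longrightarrow> f i permutes {..<n i}"
      "\<And>i j. i < t \<Longrightarrow> j < n i \<Longrightarrow> c i j = c' i (f i j)"
    by metis
  define \<Phi> where "\<Phi> = (\<lambda>(i, j). (i, f i j))"
  note \<Phi> = image_row_permutation_supports[of t f n, OF f(1), folded \<Phi>_def]
  have "krawtchouk t n m c' = (\<Sum>U\<in>supports t n m. \<Prod>(i, j)\<in>\<Phi> ` U. c' i j)"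
    unfolding krawtchouk_def by (rule sum.reindex_bij_betw[OF \<Phi>(2), symmetric])
  also have "\<dots> = krawtchouk t n m c"
    unfolding krawtchouk_def
  proof (rule sum.cong[OF refl])
    fix U assume "U \<in> supports t n m"
    then have U: "U \<subseteq> idx t n" by (simp add: supports_def)
    show "(\<Prod>(i, j)\<in>\<Phi> ` U. c' i j) = (\<Prod>(i, j)\<in>U. c i j)"
      using U f(2) by (subst prod.reindex[OF inj_on_subset[OF \<Phi>(1) U]])
        (auto simp: \<Phi>_def in_idx_def intro!: prod.cong)
  qed
  finally show ?thesis ..
qed

lemma image_mset_if_eq:
  assumes "finite A" "card {x \<in> A. T x} = card {x \<in> A. T' x}"
  shows "image_mset (\<lambda>x. if T x then u else v) (mset_set A) = image_mset (\<lambda>x. if T' x then u else v) (mset_set A)"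
proof -
  have "image_mset (\<lambda>x. if R x then u else v) (mset_set A)
      = replicate_mset (card {x \<in> A. R x}) u + replicate_mset (card A - card {x \<in> A. R x}) v" for R
    using \<open>finite A\<close>
  proof (induction A)
    case (insert x A)
    have "card {y \<in> A. R y} \<le> card A" using insert.hyps by (intro card_mono) auto
    moreover have "{y \<in> insert x A. R y} = (if R x then insert x {y \<in> A. R y} else {y \<in> A. R y})" by auto
    ultimately show ?case using insert by (simp add: Suc_diff_le)
  qed simp
  then show ?thesis using assms(2) by simp
qed

lemma supports_zero: "supports t n (\<lambda>_. 0) = {{}}"
proof -
  have "U = {}" if "U \<in> supports t n (\<lambda>_. 0)" for U
    using that finite_support_row[of U t n] by (fastforce simp: supports_def in_idx_def)
  then show ?thesis by (auto simp: supports_def)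
qed

lemma krawtchouk_degree_0: "krawtchouk t n (\<lambda>_. 0) c = 1"
  by (simp add: krawtchouk_def supports_zero)

lemma supports_unit:
  assumes k: "k < t"
  shows "supports t n (\<lambda>i. if i = k then 1 else 0) = (\<lambda>j. {(k, j)}) ` {..<n k}" (is "supports t n ?m = _")
proof (intro equalityI subsetI)
  fix U assume "U \<in> supports t n ?m"
  then have U: "U \<subseteq> idx t n" and card: "\<And>i. i < t \<Longrightarrow> card {j. (i, j) \<in> U} = ?m i"
    by (auto simp: supports_def)
  have other: "{j. (i, j) \<in> U} = {}" if "i < t" "i \<noteq> k" for i
    using card[OF that(1)] that(2) finite_support_row[OF U, of i] by simp
  from card[OF k] obtain l where l: "{j. (k, j) \<in> U} = {l}" by (auto simp: card_1_singleton_iff)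
  have "i = k \<and> j = l" if "(i, j) \<in> U" for i j
    using that other[of i] l U by (cases "i = k") (auto simp: in_idx_def)
  then have "U = {(k, l)}" using l by auto
  then show "U \<in> (\<lambda>j. {(k, j)}) ` {..<n k}" using U by (auto simp: in_idx_def)
next
  fix U assume "U \<in> (\<lambda>j. {(k, j)}) ` {..<n k}"
  then obtain l where l: "l < n k" "U = {(k, l)}" by auto
  then have "{j. (i, j) \<in> U} = (if i = k then {l} else {})" for i by auto
  then show "U \<in> supports t n ?m" using l k by (auto simp: supports_def in_idx_def)
qed

lemma krawtchouk_degree_unit:
  assumes "k < t"
  shows "krawtchouk t n (\<lambda>i. if i = k then 1 else 0) c = (\<Sum>j<n k. c k j)"
proof -
  have "inj_on (\<lambda>j. {(k, j)}) {..<n k}" by (auto intro: inj_onI)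
  then show ?thesis by (simp add: krawtchouk_def supports_unit[OF assms] sum.reindex)
qed

definition krawtchouk_value :: "nat \<Rightarrow> (nat \<Rightarrow> nat) \<Rightarrow> (nat \<Rightarrow> nat) \<Rightarrow> (nat \<Rightarrow> nat \<Rightarrow> 'c set) \<Rightarrow> (nat \<Rightarrow> nat \<Rightarrow> 'c)
    \<Rightarrow> (nat \<Rightarrow> nat) \<Rightarrow> complex" where
  "krawtchouk_value t n q Z a m = krawtchouk t n m (\<lambda>i j. if a i j \<in> Z i j then of_nat (q i) - 1 else - 1)"

lemma krawtchouk_value_degree_unit:
  assumes k: "k < t"
  shows "krawtchouk_value t n q Z a (\<lambda>i. if i = k then 1 else 0)
    = of_nat (n k) * (of_nat (q k) - 1) - of_nat (q k) * of_nat (weight_outside n Z a k)"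
proof -
  have "(\<Sum>j<n k. if a k j \<in> Z k j then of_nat (q k) - 1 else - 1 :: complex)
      = (\<Sum>j<n k. (of_nat (q k) - 1) - of_nat (q k) * (if a k j \<notin> Z k j then 1 else 0))"
    by (rule sum.cong) auto
  also have "\<dots> = of_nat (n k) * (of_nat (q k) - 1)
      - of_nat (q k) * (\<Sum>j<n k. if a k j \<notin> Z k j then 1 else 0)"
    by (simp add: sum_subtractf sum_distrib_left)
  also have "(\<Sum>j<n k. if a k j \<notin> Z k j then 1 else 0 :: complex) = of_nat (weight_outside n Z a k)"
    by (simp add: weight_outside_def sum.If_cases lessThan_def Collect_conj_eq)
  finally show ?thesis unfolding krawtchouk_value_def krawtchouk_degree_unit[OF k] .
qed

lemma krawtchouk_value_cong:
  assumes weights: "\<forall>i<t. weight_outside n Z a i = weight_outside n Z b i"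
  shows "krawtchouk_value t n q Z a m = krawtchouk_value t n q Z b m"
  unfolding krawtchouk_value_def
proof (rule krawtchouk_cong, rule image_mset_if_eq)
  fix i assume i: "i < t"
  have "card {j \<in> {..<n i}. c i j \<in> Z i j} = n i - weight_outside n Z c i" for c
  proof -
    have "{j \<in> {..<n i}. c i j \<in> Z i j} = {..<n i} - {j. j < n i \<and> c i j \<notin> Z i j}" by auto
    then show ?thesis by (simp add: weight_outside_def card_Diff_subset subset_iff)
  qed
  then show "card {j \<in> {..<n i}. a i j \<in> Z i j} = card {j \<in> {..<n i}. b i j \<in> Z i j}"
    using weights i by simp
qed simp

lemma krawtchouk_multiples_eq_iff:
  assumes q: "\<And>i j. in_idx t n i j \<Longrightarrow> q i \<noteq> 0"
  shows "(\<forall>m. z * krawtchouk_value t n q Z a m = z' * krawtchouk_value t n q Z b m)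
    \<longleftrightarrow> z = z' \<and> (z \<noteq> 0 \<longrightarrow> (\<forall>i<t. weight_outside n Z a i = weight_outside n Z b i))"
    (is "(\<forall>m. z * ?K a m = z' * ?K b m) \<longleftrightarrow> ?R")
proof
  assume eq: "\<forall>m. z * ?K a m = z' * ?K b m"
  have z: "z = z'"
    using eq[rule_format, of "\<lambda>_. 0"] by (simp add: krawtchouk_value_def krawtchouk_degree_0)
  have "weight_outside n Z a k = weight_outside n Z b k" if k: "k < t" and "z \<noteq> 0" for k
  proof (cases "n k = 0")
    case False
    then have "q k \<noteq> 0" using q[of k 0] k by (simp add: in_idx_def)
    moreover have "?K a (\<lambda>i. if i = k then 1 else 0) = ?K b (\<lambda>i. if i = k then 1 else 0)"
      using eq z \<open>z \<noteq> 0\<close> by simp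
    ultimately show ?thesis unfolding krawtchouk_value_degree_unit[OF k] by simp
  qed (simp add: weight_outside_def)
  then show ?R using z by simp
next
  assume ?R
  then show "\<forall>m. z * ?K a m = z' * ?K b m"
    using krawtchouk_value_cong[of t n Z a b q] by (cases "z = 0") auto
qed

section \<open>Product rings\<close>

locale ring_product =
  fixes t :: nat and n :: "nat \<Rightarrow> nat" and S :: "nat \<Rightarrow> nat \<Rightarrow> ('c, 'm) ring_scheme"
  assumes ring_component: "\<And>i j. in_idx t n i j \<Longrightarrow> ring (S i j)"
begin

abbreviation P :: "(nat \<Rightarrow> nat \<Rightarrow> 'c) ring" where
  "P \<equiv> prod_ring t n S"

lemmas component_simps =
  ring.ring_simprules[OF ring_component] monoid.r_one[OF ring.is_monoid[OF ring_component]]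

lemma carrier_P: "carrier P = box t n (\<lambda>i j. carrier (S i j))"
  by (simp add: prod_ring_def box_def)

lemma mem_box_iff: "a \<in> carrier P \<Longrightarrow> a \<in> box t n B \<longleftrightarrow> (\<forall>i j. in_idx t n i j \<longrightarrow> a i j \<in> B i j)"
  by (simp add: carrier_P box_def)

lemma carrier_P_component: "a \<in> carrier P \<Longrightarrow> in_idx t n i j \<Longrightarrow> a i j \<in> carrier (S i j)"
  by (simp add: prod_ring_def)

lemma P_apply:
  "(a \<otimes>\<^bsub>P\<^esub> b) i j = (if in_idx t n i j then a i j \<otimes>\<^bsub>S i j\<^esub> b i j else undefined)"
  "(a \<oplus>\<^bsub>P\<^esub> b) i j = (if in_idx t n i j then a i j \<oplus>\<^bsub>S i j\<^esub> b i j else undefined)"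
  "\<one>\<^bsub>P\<^esub> i j = (if in_idx t n i j then \<one>\<^bsub>S i j\<^esub> else undefined)"
  "\<zero>\<^bsub>P\<^esub> i j = (if in_idx t n i j then \<zero>\<^bsub>S i j\<^esub> else undefined)"
  by (simp_all add: prod_ring_def)

lemma P_eqI:
  assumes "a \<in> carrier P" "b \<in> carrier P" "\<And>i j. in_idx t n i j \<Longrightarrow> a i j = b i j"
  shows "a = b"
proof (intro ext)
  fix i j show "a i j = b i j"
    using assms by (cases "in_idx t n i j") (auto simp: prod_ring_def)
qed

lemma P_closed:
  "\<lbrakk>a \<in> carrier P; b \<in> carrier P\<rbrakk> \<Longrightarrow> a \<otimes>\<^bsub>P\<^esub> b \<in> carrier P"
  "\<lbrakk>a \<in> carrier P; b \<in> carrier P\<rbrakk> \<Longrightarrow> a \<oplus>\<^bsub>P\<^esub> b \<in> carrier P"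
  "\<one>\<^bsub>P\<^esub> \<in> carrier P" "\<zero>\<^bsub>P\<^esub> \<in> carrier P"
  "a \<in> carrier P \<Longrightarrow> (\<lambda>i j. if in_idx t n i j then \<ominus>\<^bsub>S i j\<^esub> a i j else undefined) \<in> carrier P"
  by (simp_all add: prod_ring_def component_simps)

lemma P_componentwise_minus:
  "a \<in> carrier P \<Longrightarrow> (\<lambda>i j. if in_idx t n i j then \<ominus>\<^bsub>S i j\<^esub> a i j else undefined) \<oplus>\<^bsub>P\<^esub> a = \<zero>\<^bsub>P\<^esub>"
  by (rule P_eqI) (simp_all add: P_closed P_apply carrier_P_component component_simps)

sublocale P: ring P
proof (rule ringI)
  show "abelian_group P"
  proof (rule abelian_groupI)
    fix x assume "x \<in> carrier P"
    then show "\<exists>y\<in>carrier P. y \<oplus>\<^bsub>P\<^esub> x = \<zero>\<^bsub>P\<^esub>" using P_componentwise_minus P_closed(5) by blast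
  qed (auto intro!: P_eqI simp: P_closed P_apply carrier_P_component component_simps)
  show "monoid P"
    by (rule monoidI) (auto intro!: P_eqI simp: P_closed P_apply carrier_P_component component_simps)
qed (auto intro!: P_eqI simp: P_closed P_apply carrier_P_component component_simps)

definition emb :: "nat \<Rightarrow> nat \<Rightarrow> 'c \<Rightarrow> nat \<Rightarrow> nat \<Rightarrow> 'c" where
  "emb i j x = (\<lambda>i' j'. if in_idx t n i' j' then (if i' = i \<and> j' = j then x else \<zero>\<^bsub>S i' j'\<^esub>) else undefined)"

lemma emb_apply: "in_idx t n i j \<Longrightarrow> emb i j x i j = x"
  by (simp add: emb_def)

lemma emb_closed: "x \<in> carrier (S i j) \<Longrightarrow> emb i j x \<in> carrier P"
  by (auto simp: prod_ring_def emb_def component_simps)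

lemma inj_emb: "in_idx t n i j \<Longrightarrow> inj (emb i j)"
  by (metis emb_apply injI)

lemma emb_zero: "in_idx t n i j \<Longrightarrow> emb i j \<zero>\<^bsub>S i j\<^esub> = \<zero>\<^bsub>P\<^esub>"
  by (auto simp: emb_def P_apply fun_eq_iff)

lemma emb_image_eq_zero_iff: "in_idx t n i j \<Longrightarrow> emb i j ` K = {\<zero>\<^bsub>P\<^esub>} \<longleftrightarrow> K = {\<zero>\<^bsub>S i j\<^esub>}"
  using inj_image_eq_iff[OF inj_emb, of i j K "{\<zero>\<^bsub>S i j\<^esub>}"] by (simp add: emb_zero)

lemma emb_add:
  assumes "in_idx t n i j" "x \<in> carrier (S i j)" "y \<in> carrier (S i j)"
  shows "emb i j (x \<oplus>\<^bsub>S i j\<^esub> y) = emb i j x \<oplus>\<^bsub>P\<^esub> emb i j y"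
  by (intro P_eqI emb_closed P.a_closed) (use assms in \<open>auto simp: P_apply emb_def component_simps\<close>)

lemma mult_emb_left:
  assumes "in_idx t n i j" "s \<in> carrier (S i j)" "a \<in> carrier P"
  shows "emb i j s \<otimes>\<^bsub>P\<^esub> a = emb i j (s \<otimes>\<^bsub>S i j\<^esub> a i j)"
  by (intro P_eqI emb_closed P.m_closed)
    (use assms in \<open>auto simp: P_apply emb_def carrier_P_component component_simps\<close>)

lemma mult_emb_right:
  assumes "in_idx t n i j" "s \<in> carrier (S i j)" "a \<in> carrier P"
  shows "a \<otimes>\<^bsub>P\<^esub> emb i j s = emb i j (a i j \<otimes>\<^bsub>S i j\<^esub> s)"
  by (intro P_eqI emb_closed P.m_closed)
    (use assms in \<open>auto simp: P_apply emb_def carrier_P_component component_simps\<close>)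

lemma P_emb_induct:
  assumes a: "a \<in> carrier P" and zero: "Q \<zero>\<^bsub>P\<^esub>"
    and step: "\<And>i j b. in_idx t n i j \<Longrightarrow> b \<in> carrier P \<Longrightarrow> Q b \<Longrightarrow> Q (emb i j (a i j) \<oplus>\<^bsub>P\<^esub> b)"
  shows "Q a"
proof -
  define restr where
    "restr F = (\<lambda>i j. if in_idx t n i j then if (i, j) \<in> F then a i j else \<zero>\<^bsub>S i j\<^esub> else undefined)" for F
  have closed: "restr F \<in> carrier P" for F
    using a by (auto simp: prod_ring_def restr_def component_simps)
  have "Q (restr F)" if "finite F" "F \<subseteq> idx t n" for F
    using that
  proof (induction F)
    case empty
    have "restr {} = \<zero>\<^bsub>P\<^esub>" by (auto simp: restr_def P_apply fun_eq_iff)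
    then show ?case using zero by simp
  next
    case (insert p F)
    obtain i j where p: "p = (i, j)" by (cases p)
    then have ij: "in_idx t n i j" using insert.prems by simp
    have "restr (insert p F) = emb i j (a i j) \<oplus>\<^bsub>P\<^esub> restr F"
      by (intro P_eqI closed P.a_closed emb_closed carrier_P_component[OF a ij])
        (use a ij insert.hyps p in \<open>auto simp: restr_def emb_def P_apply carrier_P_component component_simps\<close>)
    then show ?case using step[OF ij closed[of F]] insert by simp
  qed
  then have "Q (restr (idx t n))" using finite_idx by blast
  moreover have "restr (idx t n) = a"
    by (rule P_eqI[OF closed a]) (simp add: restr_def)
  ultimately show ?thesis by simp
qed

definition component_ideal :: "nat \<Rightarrow> nat \<Rightarrow> (nat \<Rightarrow> nat \<Rightarrow> 'c) set \<Rightarrow> 'c set" where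
  "component_ideal i j I = {x \<in> carrier (S i j). emb i j x \<in> I}"

lemma left_ideal_component_ideal:
  assumes I: "left_ideal P I" and ij: "in_idx t n i j"
  shows "left_ideal (S i j) (component_ideal i j I)"
proof -
  interpret S: ring "S i j" by (rule ring_component[OF ij])
  have "emb i j (r \<otimes>\<^bsub>S i j\<^esub> x) \<in> I"
    if "r \<in> carrier (S i j)" "x \<in> carrier (S i j)" "emb i j x \<in> I" for r x
    using left_ideal_mult[OF I emb_closed[OF that(1)] that(3)]
      mult_emb_left[OF ij that(1) emb_closed[OF that(2)]] by (simp add: emb_apply ij)
  then show ?thesis
    using left_ideal_zero[OF I] left_ideal_add[OF I]
    by (intro S.left_idealI) (auto simp: component_ideal_def emb_zero emb_add ij)
qed

lemma component_in_component_ideal: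
  assumes I: "left_ideal P I" and a: "a \<in> I" and ij: "in_idx t n i j"
  shows "a i j \<in> component_ideal i j I"
proof -
  interpret S: ring "S i j" by (rule ring_component[OF ij])
  have a_closed: "a \<in> carrier P" by (rule left_ideal_closed[OF I a])
  have "emb i j \<one>\<^bsub>S i j\<^esub> \<otimes>\<^bsub>P\<^esub> a = emb i j (a i j)"
    using mult_emb_left[OF ij S.one_closed a_closed] carrier_P_component[OF a_closed ij] by simp
  then show ?thesis
    using left_ideal_mult[OF I emb_closed[OF S.one_closed] a] carrier_P_component[OF a_closed ij]
    by (simp add: component_ideal_def)
qed

lemma left_ideal_P_memI:
  assumes I: "left_ideal P I" and a: "a \<in> carrier P"
    and comps: "\<And>i j. in_idx t n i j \<Longrightarrow> a i j \<in> component_ideal i j I"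
  shows "a \<in> I"
proof (rule P_emb_induct[of a "\<lambda>a. a \<in> I"])
  fix i j b assume "in_idx t n i j" "b \<in> I"
  then show "emb i j (a i j) \<oplus>\<^bsub>P\<^esub> b \<in> I"
    using comps left_ideal_add[OF I] by (simp add: component_ideal_def)
qed (rule a left_ideal_zero[OF I])+

lemma left_ideal_emb_image:
  assumes K: "left_ideal (S i j) K" and ij: "in_idx t n i j"
  shows "left_ideal P (emb i j ` K)"
proof (rule P.left_idealI)
  note K_closed = left_ideal_closed[OF K]
  show "emb i j ` K \<subseteq> carrier P" using K_closed emb_closed by blast
  show "\<zero>\<^bsub>P\<^esub> \<in> emb i j ` K" using left_ideal_zero[OF K] emb_zero[OF ij] by (metis imageI)
  show "a \<oplus>\<^bsub>P\<^esub> b \<in> emb i j ` K" if "a \<in> emb i j ` K" "b \<in> emb i j ` K" for a b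
    using that left_ideal_add[OF K] K_closed by (auto simp flip: emb_add[OF ij])
  show "r \<otimes>\<^bsub>P\<^esub> a \<in> emb i j ` K" if "r \<in> carrier P" "a \<in> emb i j ` K" for r a
    using that left_ideal_mult[OF K carrier_P_component[OF that(1) ij]] K_closed
    by (auto simp: mult_emb_right ij)
qed

definition component_preimage :: "nat \<Rightarrow> nat \<Rightarrow> 'c set \<Rightarrow> (nat \<Rightarrow> nat \<Rightarrow> 'c) set" where
  "component_preimage i j K = {a \<in> carrier P. a i j \<in> K}"

lemma left_ideal_component_preimage:
  assumes K: "left_ideal (S i j) K" and ij: "in_idx t n i j"
  shows "left_ideal P (component_preimage i j K)"
  using left_ideal_zero[OF K] left_ideal_add[OF K] left_ideal_mult[OF K carrier_P_component[OF _ ij]]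
  by (intro P.left_idealI) (auto simp: component_preimage_def P_apply ij)

lemma emb_in_component_preimage_iff:
  "in_idx t n i j \<Longrightarrow> x \<in> carrier (S i j) \<Longrightarrow> emb i j x \<in> component_preimage i j K \<longleftrightarrow> x \<in> K"
  by (simp add: component_preimage_def emb_closed emb_apply)

lemma component_preimage_proper:
  assumes "K \<noteq> carrier (S i j)" "K \<subseteq> carrier (S i j)" and ij: "in_idx t n i j"
  shows "component_preimage i j K \<noteq> carrier P"
  using assms emb_in_component_preimage_iff[OF ij] emb_closed by blast

lemma emb_image_component_ideal_subset: "emb i j ` component_ideal i j I \<subseteq> I"
  by (auto simp: component_ideal_def)

lemma minimal_left_ideal_emb_image:
  assumes K: "minimal_left_ideal (S i j) K" and ij: "in_idx t n i j"
  shows "minimal_left_ideal P (emb i j ` K)"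
proof -
  have ideal: "left_ideal (S i j) K" "K \<noteq> {\<zero>\<^bsub>S i j\<^esub>}" using K by (simp_all add: minimal_left_ideal_def)
  have "J = emb i j ` K" if J: "left_ideal P J" "J \<subseteq> emb i j ` K" "J \<noteq> {\<zero>\<^bsub>P\<^esub>}" for J
  proof -
    obtain a where a: "a \<in> J" "a \<noteq> \<zero>\<^bsub>P\<^esub>" using J(1,3) by (rule left_ideal_nonzeroE)
    then obtain x where x: "x \<in> K" "a = emb i j x" using J(2) by blast
    have "x \<in> component_ideal i j J"
      using component_in_component_ideal[OF J(1) a(1) ij] x(2) ij by (simp add: emb_apply)
    moreover have "x \<noteq> \<zero>\<^bsub>S i j\<^esub>" using a(2) x(2) emb_zero[OF ij] by auto
    ultimately have "component_ideal i j J \<noteq> {\<zero>\<^bsub>S i j\<^esub>}" by blast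
    moreover have "component_ideal i j J \<subseteq> K"
      using J(2) injD[OF inj_emb[OF ij]] by (fastforce simp: component_ideal_def)
    ultimately have "component_ideal i j J = K"
      using K left_ideal_component_ideal[OF J(1) ij] by (simp add: minimal_left_ideal_def)
    then show ?thesis using J(2) emb_image_component_ideal_subset by blast
  qed
  then show ?thesis
    unfolding minimal_left_ideal_def
    using left_ideal_emb_image[OF ideal(1) ij] ideal(2) by (simp add: emb_image_eq_zero_iff[OF ij])
qed

lemma minimal_left_ideal_P_cases:
  assumes I: "minimal_left_ideal P I"
  obtains i j K where "in_idx t n i j" "minimal_left_ideal (S i j) K" "I = emb i j ` K"
proof -
  have ideal: "left_ideal P I" "I \<noteq> {\<zero>\<^bsub>P\<^esub>}" using I by (simp_all add: minimal_left_ideal_def)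
  obtain a where a: "a \<in> I" "a \<noteq> \<zero>\<^bsub>P\<^esub>" using ideal by (rule left_ideal_nonzeroE)
  then obtain i j where ij: "in_idx t n i j" "a i j \<noteq> \<zero>\<^bsub>S i j\<^esub>"
    using P_eqI[OF left_ideal_closed[OF ideal(1) a(1)] P.zero_closed] by (auto simp: P_apply)
  let ?K = "component_ideal i j I"
  have K: "left_ideal (S i j) ?K" by (rule left_ideal_component_ideal[OF ideal(1) ij(1)])
  have eq: "emb i j ` L = I" if L: "left_ideal (S i j) L" "L \<subseteq> ?K" "L \<noteq> {\<zero>\<^bsub>S i j\<^esub>}" for L
  proof -
    have "emb i j ` L \<subseteq> I" using L(2) emb_image_component_ideal_subset by blast
    then show ?thesis
      using I left_ideal_emb_image[OF L(1) ij(1)] L(3)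
      by (simp add: minimal_left_ideal_def emb_image_eq_zero_iff[OF ij(1)])
  qed
  have nonzero: "?K \<noteq> {\<zero>\<^bsub>S i j\<^esub>}"
    using component_in_component_ideal[OF ideal(1) a(1) ij(1)] ij(2) by blast
  then have I_eq: "emb i j ` ?K = I" by (rule eq[OF K subset_refl])
  have "L = ?K" if "left_ideal (S i j) L" "L \<subseteq> ?K" "L \<noteq> {\<zero>\<^bsub>S i j\<^esub>}" for L
    using eq[OF that] I_eq inj_image_eq_iff[OF inj_emb[OF ij(1)]] by metis
  then have "minimal_left_ideal (S i j) ?K"
    using K nonzero by (simp add: minimal_left_ideal_def)
  then show ?thesis using that[OF ij(1)] I_eq by blast
qed

lemma left_ideal_lsoc_component: "in_idx t n i j \<Longrightarrow> left_ideal (S i j) (lsoc (S i j))"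
  by (rule ring.left_ideal_lsoc[OF ring_component])

lemma left_ideal_jrad_component: "in_idx t n i j \<Longrightarrow> left_ideal (S i j) (jrad (S i j))"
  by (rule ring.left_ideal_jrad[OF ring_component])

lemma box_left_ideals_subset_carrier:
  assumes "\<And>i j. in_idx t n i j \<Longrightarrow> left_ideal (S i j) (B i j)"
  shows "box t n B \<subseteq> carrier P"
  unfolding carrier_P by (rule box_mono) (use assms in \<open>simp add: left_ideal_def\<close>)

lemma lsoc_component_subset:
  assumes ij: "in_idx t n i j"
  shows "lsoc (S i j) \<subseteq> component_ideal i j (lsoc P)"
proof (rule lsoc_least[OF left_ideal_component_ideal[OF P.left_ideal_lsoc ij]])
  fix K assume K: "minimal_left_ideal (S i j) K"
  then have "K \<subseteq> carrier (S i j)" by (simp add: minimal_left_ideal_def left_ideal_def)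
  then show "K \<subseteq> component_ideal i j (lsoc P)"
    using minimal_left_ideal_subset_lsoc[OF minimal_left_ideal_emb_image[OF K ij]]
    by (auto simp: component_ideal_def)
qed

lemma lsoc_P_subset:
  assumes ij: "in_idx t n i j"
  shows "lsoc P \<subseteq> component_preimage i j (lsoc (S i j))"
proof (rule lsoc_least[OF left_ideal_component_preimage[OF left_ideal_lsoc_component[OF ij] ij]])
  fix I assume "minimal_left_ideal P I"
  then obtain i' j' K where K: "in_idx t n i' j'" "minimal_left_ideal (S i' j') K" "I = emb i' j' ` K"
    by (rule minimal_left_ideal_P_cases)
  have "emb i' j' x i j \<in> lsoc (S i j)" if "x \<in> K" for x
    using that minimal_left_ideal_subset_lsoc[OF K(2)] ij
      left_ideal_zero[OF left_ideal_lsoc_component[OF ij]] by (auto simp: emb_def)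
  moreover have "K \<subseteq> carrier (S i' j')" using K(2) by (simp add: minimal_left_ideal_def left_ideal_def)
  ultimately show "I \<subseteq> component_preimage i j (lsoc (S i j))"
    using K(3) emb_closed by (auto simp: component_preimage_def)
qed

lemma lsoc_P: "lsoc P = box t n (\<lambda>i j. lsoc (S i j))"
proof (intro equalityI subsetI)
  fix a assume a: "a \<in> lsoc P"
  then have "a i j \<in> lsoc (S i j)" if "in_idx t n i j" for i j
    using lsoc_P_subset[OF that] by (auto simp: component_preimage_def)
  then show "a \<in> box t n (\<lambda>i j. lsoc (S i j))"
    using mem_box_iff[OF left_ideal_closed[OF P.left_ideal_lsoc a]] by blast
next
  fix a assume a: "a \<in> box t n (\<lambda>i j. lsoc (S i j))"
  then have "a \<in> carrier P"
    using box_left_ideals_subset_carrier[OF left_ideal_lsoc_component] by blast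
  then show "a \<in> lsoc P"
    by (rule left_ideal_P_memI[OF P.left_ideal_lsoc])
      (use box_component[OF a] lsoc_component_subset in blast)
qed

lemma left_ideal_subset_component_preimage:
  assumes "left_ideal P J" "in_idx t n i j"
  shows "J \<subseteq> component_preimage i j (component_ideal i j J)"
  using component_in_component_ideal[OF assms(1) _ assms(2)] left_ideal_closed[OF assms(1)]
  by (auto simp: component_preimage_def)

lemma component_ideal_proper:
  assumes J: "left_ideal P J" "J \<noteq> carrier P" "component_preimage i j {\<zero>\<^bsub>S i j\<^esub>} \<subseteq> J"
    and ij: "in_idx t n i j"
  shows "component_ideal i j J \<noteq> carrier (S i j)"
proof
  assume full: "component_ideal i j J = carrier (S i j)"
  have "a i' j' \<in> component_ideal i' j' J" if a: "a \<in> carrier P" and ij': "in_idx t n i' j'" for a i' j'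
  proof (cases "(i', j') = (i, j)")
    case True
    then show ?thesis using full carrier_P_component[OF a ij'] by simp
  next
    case False
    then have "emb i' j' (a i' j') i j = \<zero>\<^bsub>S i j\<^esub>" using ij by (auto simp: emb_def)
    then have "emb i' j' (a i' j') \<in> component_preimage i j {\<zero>\<^bsub>S i j\<^esub>}"
      using emb_closed[OF carrier_P_component[OF a ij']] by (simp add: component_preimage_def)
    then show ?thesis using J(3) carrier_P_component[OF a ij'] by (auto simp: component_ideal_def)
  qed
  then have "carrier P \<subseteq> J" using left_ideal_P_memI[OF J(1)] by blast
  then show False using J(1,2) by (auto simp: left_ideal_def)
qed

lemma maximal_left_ideal_component_preimage:
  assumes M: "maximal_left_ideal (S i j) M" and ij: "in_idx t n i j"
  shows "maximal_left_ideal P (component_preimage i j M)"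
proof -
  have ideal: "left_ideal (S i j) M" "M \<noteq> carrier (S i j)" using M by (simp_all add: maximal_left_ideal_def)
  then have "M \<subseteq> carrier (S i j)" by (simp add: left_ideal_def)
  have "J = component_preimage i j M"
    if J: "left_ideal P J" "component_preimage i j M \<subseteq> J" "J \<noteq> carrier P" for J
  proof -
    have "component_preimage i j {\<zero>\<^bsub>S i j\<^esub>} \<subseteq> component_preimage i j M"
      using left_ideal_zero[OF ideal(1)] by (auto simp: component_preimage_def)
    then have "component_ideal i j J \<noteq> carrier (S i j)"
      using J by (intro component_ideal_proper ij) auto
    moreover have "M \<subseteq> component_ideal i j J"
      using \<open>M \<subseteq> carrier (S i j)\<close> J(2) emb_in_component_preimage_iff[OF ij]
      by (auto simp: component_ideal_def)
    ultimately have "component_ideal i j J = M"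
      using M left_ideal_component_ideal[OF J(1) ij] by (simp add: maximal_left_ideal_def)
    then show ?thesis using left_ideal_subset_component_preimage[OF J(1) ij] J(2) by blast
  qed
  then show ?thesis
    unfolding maximal_left_ideal_def
    using left_ideal_component_preimage[OF ideal(1) ij]
      component_preimage_proper[OF ideal(2) \<open>M \<subseteq> carrier (S i j)\<close> ij] by blast
qed

lemma maximal_left_ideal_P_cases:
  assumes J: "maximal_left_ideal P J"
  obtains i j M where "in_idx t n i j" "maximal_left_ideal (S i j) M" "J = component_preimage i j M"
proof -
  have ideal: "left_ideal P J" "J \<noteq> carrier P" using J by (simp_all add: maximal_left_ideal_def)
  have "\<exists>i j. in_idx t n i j \<and> component_ideal i j J \<noteq> carrier (S i j)"
  proof (rule ccontr)
    assume "\<not> ?thesis"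
    then have "carrier P \<subseteq> J"
      using left_ideal_P_memI[OF ideal(1)] carrier_P_component by (metis subsetI)
    then show False using ideal by (auto simp: left_ideal_def)
  qed
  then obtain i j where ij: "in_idx t n i j" and proper: "component_ideal i j J \<noteq> carrier (S i j)" by blast
  let ?M = "component_ideal i j J"
  have eq: "component_preimage i j L = J"
    if L: "left_ideal (S i j) L" "?M \<subseteq> L" "L \<noteq> carrier (S i j)" for L
  proof -
    have "L \<subseteq> carrier (S i j)" using L(1) by (simp add: left_ideal_def)
    moreover have "J \<subseteq> component_preimage i j L"
      using left_ideal_subset_component_preimage[OF ideal(1) ij] L(2) by (auto simp: component_preimage_def)
    ultimately show ?thesis
      using J left_ideal_component_preimage[OF L(1) ij] component_preimage_proper[OF L(3) _ ij]
      by (simp add: maximal_left_ideal_def)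
  qed
  have M: "left_ideal (S i j) ?M" by (rule left_ideal_component_ideal[OF ideal(1) ij])
  have "L = ?M" if L: "left_ideal (S i j) L" "?M \<subseteq> L" "L \<noteq> carrier (S i j)" for L
    using eq[OF L] emb_in_component_preimage_iff[OF ij] left_ideal_closed[OF L(1)] L(2)
    by (auto simp: component_ideal_def)
  then have "maximal_left_ideal (S i j) ?M"
    using M proper by (simp add: maximal_left_ideal_def)
  moreover have "J = component_preimage i j ?M" using eq[OF M subset_refl proper] by simp
  ultimately show ?thesis using that[OF ij] by blast
qed

lemma jrad_P: "jrad P = box t n (\<lambda>i j. jrad (S i j))"
proof (intro equalityI subsetI)
  fix a assume a: "a \<in> jrad P"
  have "a i j \<in> jrad (S i j)" if ij: "in_idx t n i j" for i j
    unfolding jrad_def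
  proof (intro IntI InterI)
    show "a i j \<in> carrier (S i j)" by (rule carrier_P_component[OF jrad_closed[OF a] ij])
    fix M assume "M \<in> {M. maximal_left_ideal (S i j) M}"
    then have "a \<in> component_preimage i j M"
      using a maximal_left_ideal_component_preimage[OF _ ij] by (auto simp: jrad_def)
    then show "a i j \<in> M" by (simp add: component_preimage_def)
  qed
  then show "a \<in> box t n (\<lambda>i j. jrad (S i j))"
    using mem_box_iff[OF jrad_closed[OF a]] by blast
next
  fix a assume a: "a \<in> box t n (\<lambda>i j. jrad (S i j))"
  then have a_closed: "a \<in> carrier P"
    using box_left_ideals_subset_carrier[OF left_ideal_jrad_component] by blast
  have "a \<in> J" if "maximal_left_ideal P J" for J
    using that
  proof (rule maximal_left_ideal_P_cases)
    fix i j M assume M: "in_idx t n i j" "maximal_left_ideal (S i j) M" "J = component_preimage i j M"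
    then have "a i j \<in> M" using box_component[OF a M(1)] by (auto simp: jrad_def)
    then show "a \<in> J" using M(3) a_closed by (simp add: component_preimage_def)
  qed
  then show "a \<in> jrad P" using a_closed by (auto simp: jrad_def)
qed

end

section \<open>The homogeneous weight\<close>

definition hom_factor :: "('a, 'm) ring_scheme \<Rightarrow> 'a \<Rightarrow> rat" where
  "hom_factor R x = (if x = \<zero>\<^bsub>R\<^esub> then 1 else if x \<in> lsoc R then - 1 / (of_nat (card (lsoc R)) - 1) else 0)"

context simple_socle_ring
begin

lemma sum_hom_factor:
  assumes I: "left_ideal R I" "I \<noteq> {\<zero>}"
  shows "sum (hom_factor R) I = 0"
proof -
  let ?q = "card (lsoc R)"
  note zero = left_ideal_zero[OF left_ideal_lsoc] and finite = finite_left_ideal[OF left_ideal_lsoc]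
  have "sum (hom_factor R) I = sum (hom_factor R) (lsoc R)"
    by (rule sum.mono_neutral_right[OF finite_left_ideal[OF I(1)] lsoc_subset_left_ideal[OF I]])
      (use zero in \<open>auto simp: hom_factor_def\<close>)
  also have "\<dots> = hom_factor R \<zero> + sum (hom_factor R) (lsoc R - {\<zero>})"
    by (rule sum.remove[OF finite zero])
  also have "sum (hom_factor R) (lsoc R - {\<zero>}) = of_nat (?q - 1) * (- 1 / (of_nat ?q - 1))"
    using zero by (simp add: hom_factor_def card_Diff_subset)
  also have "hom_factor R \<zero> + \<dots> = 0"
    using card_lsoc_ge_2 by (simp add: hom_factor_def of_nat_diff)
  finally show ?thesis .
qed

lemma hom_factor_eq_0_iff: "hom_factor R x = 0 \<longleftrightarrow> x \<notin> lsoc R"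
  using card_lsoc_ge_2 left_ideal_zero[OF left_ideal_lsoc] by (auto simp: hom_factor_def)

lemma hom_factor_cong:
  assumes xy: "x \<in> carrier R" "y \<in> carrier R" and eq: "left_principal R x = left_principal R y"
  shows "hom_factor R x = hom_factor R y"
proof -
  have "x \<in> I \<longleftrightarrow> y \<in> I" if "left_ideal R I" for I
    using that left_principal_subset_left_ideal[OF that] left_principal_self[OF xy(1)]
      left_principal_self[OF xy(2)] eq by blast
  from this[OF left_ideal_lsoc] this[OF left_ideal_zero_ideal] show ?thesis
    by (simp add: hom_factor_def)
qed

end

lemma sign_quotient_eq_iff:
  fixes d e :: int
  assumes "d > 0" "e > 0"
  shows "(- 1) ^ k / of_int d = ((- 1) ^ l / of_int e :: rat) \<longleftrightarrow> d = e \<and> k mod 2 = l mod 2"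
proof
  assume eq: "(- 1) ^ k / of_int d = ((- 1) ^ l / of_int e :: rat)"
  then have "\<bar>(- 1) ^ k / of_int d :: rat\<bar> = \<bar>(- 1) ^ l / of_int e\<bar>" by simp
  then have "d = e" using assms by (simp add: abs_divide power_abs)
  moreover have "(- 1) ^ k = ((- 1) ^ l :: rat)" using eq \<open>d = e\<close> assms by simp
  then have "k mod 2 = l mod 2"
    by (cases "even k"; cases "even l") (auto simp: even_iff_mod_2_eq_zero odd_iff_mod_2_eq_one)
  ultimately show "d = e \<and> k mod 2 = l mod 2" ..
next
  assume "d = e \<and> k mod 2 = l mod 2"
  then show "(- 1) ^ k / of_int d = ((- 1) ^ l / of_int e :: rat)"
    by (cases "even k"; cases "even l") (auto simp: even_iff_mod_2_eq_zero odd_iff_mod_2_eq_one)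
qed

locale simple_socle_product =
  fixes t :: nat and n q :: "nat \<Rightarrow> nat" and S :: "nat \<Rightarrow> nat \<Rightarrow> ('c, 'm) ring_scheme"
  assumes simple_socle_component: "\<And>i j. in_idx t n i j \<Longrightarrow> simple_socle_ring (S i j)"
    and card_lsoc_component: "\<And>i j. in_idx t n i j \<Longrightarrow> card (lsoc (S i j)) = q i"
begin

lemma finite_local_component: "in_idx t n i j \<Longrightarrow> finite_local_ring (S i j)"
  by (rule simple_socle_ring.axioms(1)[OF simple_socle_component])

lemma finite_component: "in_idx t n i j \<Longrightarrow> finite_ring (S i j)"
  by (rule finite_local_ring.axioms(1)[OF finite_local_component])

sublocale ring_product t n S
  by (rule ring_product.intro) (rule finite_ring.axioms(1)[OF finite_component])

sublocale P: finite_ring P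
  by unfold_locales
    (auto simp: carrier_P intro!: finite_box finite_ring.finite_carrier[OF finite_component])

lemma q_ge_2: "in_idx t n i j \<Longrightarrow> q i \<ge> 2"
  using finite_local_ring.card_lsoc_ge_2[OF finite_local_component] card_lsoc_component by metis

lemma lsoc_P_closed: "a \<in> lsoc P \<Longrightarrow> a \<in> carrier P"
  by (rule left_ideal_closed[OF P.left_ideal_lsoc])

lemma lsoc_P_iff: "a \<in> carrier P \<Longrightarrow> a \<in> lsoc P \<longleftrightarrow> (\<forall>i j. in_idx t n i j \<longrightarrow> a i j \<in> lsoc (S i j))"
  by (simp only: lsoc_P mem_box_iff)

lemma left_principal_P:
  assumes x: "x \<in> carrier P"
  shows "left_principal P x = box t n (\<lambda>i j. left_principal (S i j) (x i j))" (is "_ = box t n ?B")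
proof (intro equalityI subsetI)
  fix a assume "a \<in> left_principal P x"
  then show "a \<in> box t n ?B" by (auto simp: box_def P_apply carrier_P_component)
next
  fix a assume a: "a \<in> box t n ?B"
  have "\<forall>i j. \<exists>r. in_idx t n i j \<longrightarrow> r \<in> carrier (S i j) \<and> a i j = r \<otimes>\<^bsub>S i j\<^esub> x i j"
    using box_component[OF a] by blast
  then obtain r where r: "\<And>i j. in_idx t n i j \<Longrightarrow> r i j \<in> carrier (S i j) \<and> a i j = r i j \<otimes>\<^bsub>S i j\<^esub> x i j"
    by metis
  let ?r = "\<lambda>i j. if in_idx t n i j then r i j else undefined"
  have "?r \<in> carrier P" using r by (simp add: prod_ring_def)
  moreover have "a = ?r \<otimes>\<^bsub>P\<^esub> x"
    using a r by (auto simp: box_def P_apply fun_eq_iff)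
  ultimately show "a \<in> left_principal P x" by blast
qed

lemma left_principal_component:
  assumes x: "x \<in> carrier P" and ij: "in_idx t n i j"
  shows "left_principal (S i j) (x i j) = (\<lambda>a. a i j) ` left_principal P x"
proof (intro equalityI subsetI)
  fix y assume "y \<in> left_principal (S i j) (x i j)"
  then obtain s where s: "s \<in> carrier (S i j)" "y = s \<otimes>\<^bsub>S i j\<^esub> x i j" by blast
  then have "y = (emb i j s \<otimes>\<^bsub>P\<^esub> x) i j" using ij by (simp add: P_apply emb_apply)
  then show "y \<in> (\<lambda>a. a i j) ` left_principal P x" using emb_closed[OF s(1)] by blast
qed (auto simp: P_apply ij carrier_P_component)

definition hom_prod :: "(nat \<Rightarrow> nat \<Rightarrow> 'c) \<Rightarrow> rat" where
  "hom_prod a = (\<Prod>(i, j)\<in>idx t n. hom_factor (S i j) (a i j))"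

lemma hom_prod_cong:
  assumes xy: "x \<in> carrier P" "y \<in> carrier P" and eq: "left_principal P x = left_principal P y"
  shows "hom_prod x = hom_prod y"
  unfolding hom_prod_def
proof (rule prod_idx_cong)
  fix i j assume ij: "in_idx t n i j"
  have "left_principal (S i j) (x i j) = left_principal (S i j) (y i j)"
    using left_principal_component[OF xy(1) ij] left_principal_component[OF xy(2) ij] eq by simp
  then show "hom_factor (S i j) (x i j) = hom_factor (S i j) (y i j)"
    by (intro simple_socle_ring.hom_factor_cong simple_socle_component carrier_P_component xy ij)
qed

lemma sum_hom_prod_left_principal:
  assumes x: "x \<in> carrier P" "x \<noteq> \<zero>\<^bsub>P\<^esub>"
  shows "sum hom_prod (left_principal P x) = 0"
proof -
  let ?B = "\<lambda>i j. left_principal (S i j) (x i j)"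
  obtain i j where ij: "in_idx t n i j" "x i j \<noteq> \<zero>\<^bsub>S i j\<^esub>"
    using P_eqI[OF x(1) P.zero_closed] x(2) by (auto simp: P_apply)
  interpret C: simple_socle_ring "S i j" by (rule simple_socle_component[OF ij(1)])
  have "sum (hom_factor (S i j)) (?B i j) = 0"
    using ij carrier_P_component[OF x(1) ij(1)]
    by (intro C.sum_hom_factor C.left_ideal_left_principal) (simp_all add: C.left_principal_eq_zero_iff)
  then have "(\<Prod>(i, j)\<in>idx t n. sum (hom_factor (S i j)) (?B i j)) = 0"
    using ij(1) by (auto simp: prod_idx_eq_0_iff)
  moreover have "sum hom_prod (box t n ?B) = (\<Prod>(i, j)\<in>idx t n. sum (hom_factor (S i j)) (?B i j))"
    unfolding hom_prod_def
    by (rule sum_box_prod) (simp add: finite_ring.finite_carrier[OF finite_component])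
  ultimately show ?thesis unfolding left_principal_P[OF x(1)] by simp
qed

lemma hom_weight_P:
  assumes "a \<in> carrier P"
  shows "hom_weight P a = 1 - hom_prod a"
proof (rule P.hom_weight_eq_one_minus[OF _ hom_prod_cong sum_hom_prod_left_principal assms])
  show "hom_prod \<zero>\<^bsub>P\<^esub> = 1"
    unfolding hom_prod_def by (rule prod.neutral) (auto simp: hom_factor_def P_apply)
qed

lemma hom_prod_eq_0_iff:
  assumes "a \<in> carrier P"
  shows "hom_prod a = 0 \<longleftrightarrow> a \<notin> lsoc P"
  unfolding hom_prod_def prod_idx_eq_0_iff lsoc_P_iff[OF assms]
  using simple_socle_ring.hom_factor_eq_0_iff[OF simple_socle_component] by blast

lemma hom_prod_lsoc:
  assumes a: "a \<in> lsoc P"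
  shows "hom_prod a = (- 1) ^ (\<Sum>i<t. wt n S a i) / of_int (\<Prod>i<t. (int (q i) - 1) ^ wt n S a i)"
proof -
  have row: "(\<Prod>j<n i. hom_factor (S i j) (a i j)) = (- 1) ^ wt n S a i / (of_nat (q i) - 1) ^ wt n S a i"
    if i: "i < t" for i
  proof -
    have "(\<Prod>j<n i. hom_factor (S i j) (a i j))
        = (\<Prod>j<n i. if a i j \<noteq> \<zero>\<^bsub>S i j\<^esub> then - 1 / (of_nat (q i) - 1) else 1)"
    proof (rule prod.cong[OF refl])
      fix j assume "j \<in> {..<n i}"
      then have ij: "in_idx t n i j" using i by (simp add: in_idx_def)
      then show "hom_factor (S i j) (a i j) = (if a i j \<noteq> \<zero>\<^bsub>S i j\<^esub> then - 1 / (of_nat (q i) - 1) else 1)"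
        using box_component[OF a[unfolded lsoc_P] ij] by (simp add: hom_factor_def card_lsoc_component)
    qed
    also have "\<dots> = (- 1 / (of_nat (q i) - 1)) ^ wt n S a i"
      by (simp add: prod.If_cases wt_def lessThan_def Collect_conj_eq)
    finally show ?thesis by (simp only: power_divide)
  qed
  have "hom_prod a = (\<Prod>i<t. \<Prod>j<n i. hom_factor (S i j) (a i j))"
    unfolding hom_prod_def idx_eq_Sigma by (rule prod.Sigma[symmetric]) auto
  also have "\<dots> = (\<Prod>i<t. (- 1) ^ wt n S a i / (of_nat (q i) - 1) ^ wt n S a i)"
    by (rule prod.cong) (use row in auto)
  also have "\<dots> = (- 1) ^ (\<Sum>i<t. wt n S a i) / of_int (\<Prod>i<t. (int (q i) - 1) ^ wt n S a i)"
    by (simp add: prod_dividef power_sum)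
  finally show ?thesis .
qed

lemma wt_eq_weight_outside: "wt n S a = weight_outside n (\<lambda>i j. {\<zero>\<^bsub>S i j\<^esub>}) a"
  by (simp add: wt_def weight_outside_def fun_eq_iff)

lemma prod_q_minus_1_pos: "(\<Prod>i<t. (int (q i) - 1) ^ wt n S a i) > 0"
proof (rule prod_pos)
  fix i assume "i \<in> {..<t}"
  moreover have "wt n S a i \<le> n i" by (simp add: wt_eq_weight_outside weight_outside_le)
  ultimately show "(int (q i) - 1) ^ wt n S a i > 0"
    using q_ge_2[of i 0] by (cases "wt n S a i = 0") (auto simp: in_idx_def)
qed

definition socle_weight_equiv :: "(nat \<Rightarrow> nat \<Rightarrow> 'c) \<Rightarrow> (nat \<Rightarrow> nat \<Rightarrow> 'c) \<Rightarrow> bool" where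
  "socle_weight_equiv a b \<longleftrightarrow> (a \<in> lsoc P \<longleftrightarrow> b \<in> lsoc P) \<and> (a \<in> lsoc P \<longrightarrow> (\<forall>i<t. wt n S a i = wt n S b i))"

lemma hom_weight_eq_iff:
  assumes sep: "separating t n q" and ab: "a \<in> carrier P" "b \<in> carrier P"
  shows "hom_weight P a = hom_weight P b \<longleftrightarrow> socle_weight_equiv a b"
proof (cases "a \<in> lsoc P \<and> b \<in> lsoc P")
  case True
  let ?d = "\<lambda>c. \<Prod>i<t. (int (q i) - 1) ^ wt n S c i" and ?s = "\<lambda>c. \<Sum>i<t. wt n S c i"
  have "hom_weight P a = hom_weight P b \<longleftrightarrow> ?d a = ?d b \<and> ?s a mod 2 = ?s b mod 2"
    using True hom_prod_lsoc[of a] hom_prod_lsoc[of b]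
      sign_quotient_eq_iff[OF prod_q_minus_1_pos prod_q_minus_1_pos, of "?s a" a "?s b" b]
    by (simp only: hom_weight_P ab) simp
  also have "\<dots> \<longleftrightarrow> (\<forall>i<t. wt n S a i = wt n S b i)"
  proof
    have "in_M t n (wt n S c)" for c by (simp add: wt_eq_weight_outside in_M_weight_outside)
    then show "\<forall>i<t. wt n S a i = wt n S b i" if "?d a = ?d b \<and> ?s a mod 2 = ?s b mod 2"
      using sep that unfolding separating_def by blast
  qed (simp cong: prod.cong_simp sum.cong_simp)
  finally show ?thesis using True by (simp add: socle_weight_equiv_def)
next
  case False
  have "hom_weight P a = hom_weight P b \<longleftrightarrow> hom_prod a = hom_prod b" by (simp add: hom_weight_P ab)
  then show ?thesis
    using False hom_prod_eq_0_iff[OF ab(1)] hom_prod_eq_0_iff[OF ab(2)]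
    by (auto simp: socle_weight_equiv_def)
qed

end

section \<open>Dual partitions\<close>

definition partition_by :: "'a set \<Rightarrow> ('a \<Rightarrow> 'a \<Rightarrow> bool) \<Rightarrow> 'a set set" where
  "partition_by A r = (\<lambda>x. {y \<in> A. r x y}) ` A"

lemma partition_by_cong:
  "(\<And>x y. x \<in> A \<Longrightarrow> y \<in> A \<Longrightarrow> r x y \<longleftrightarrow> s x y) \<Longrightarrow> partition_by A r = partition_by A s"
  unfolding partition_by_def by (intro image_cong refl) auto

lemma eq_partition_byI:
  assumes union: "\<Union>Q = A" and nonempty: "{} \<notin> Q"
    and block_eq: "\<And>B x. B \<in> Q \<Longrightarrow> x \<in> B \<Longrightarrow> B = {y \<in> A. r x y}"
  shows "Q = partition_by A r"
proof (intro equalityI subsetI)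
  fix B assume B: "B \<in> Q"
  then obtain x where "x \<in> B" using nonempty by (metis ex_in_conv)
  then show "B \<in> partition_by A r"
    unfolding partition_by_def using union B block_eq[OF B] by blast
next
  fix B assume "B \<in> partition_by A r"
  then obtain x where x: "x \<in> A" "B = {y \<in> A. r x y}" by (auto simp: partition_by_def)
  then obtain C where "C \<in> Q" "x \<in> C" using union by blast
  then show "B \<in> Q" using block_eq x(2) by metis
qed

lemma left_dual_eq_partition_by:
  "left_dual R \<chi> Q = partition_by (carrier R)
    (\<lambda>a b. \<forall>B\<in>Q. (\<Sum>x\<in>B. \<chi> (x \<otimes>\<^bsub>R\<^esub> a)) = (\<Sum>x\<in>B. \<chi> (x \<otimes>\<^bsub>R\<^esub> b)))"
  by (simp add: left_dual_def partition_by_def)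

lemma right_dual_eq_partition_by:
  "right_dual R \<chi> Q = partition_by (carrier R)
    (\<lambda>a b. \<forall>B\<in>Q. (\<Sum>x\<in>B. \<chi> (a \<otimes>\<^bsub>R\<^esub> x)) = (\<Sum>x\<in>B. \<chi> (b \<otimes>\<^bsub>R\<^esub> x)))"
  by (simp add: right_dual_def partition_by_def)

context simple_socle_product
begin

abbreviation socle_block :: "(nat \<Rightarrow> nat) \<Rightarrow> (nat \<Rightarrow> nat \<Rightarrow> 'c) set" where
  "socle_block \<equiv> weight_block t n (\<lambda>i j. lsoc (S i j)) (\<lambda>i j. {\<zero>\<^bsub>S i j\<^esub>})"

abbreviation unit_wt :: "(nat \<Rightarrow> nat \<Rightarrow> 'c) \<Rightarrow> nat \<Rightarrow> nat" where
  "unit_wt \<equiv> weight_outside n (\<lambda>i j. jrad (S i j))"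

abbreviation unit_block :: "(nat \<Rightarrow> nat) \<Rightarrow> (nat \<Rightarrow> nat \<Rightarrow> 'c) set" where
  "unit_block \<equiv> weight_block t n (\<lambda>i j. carrier (S i j)) (\<lambda>i j. jrad (S i j))"

definition unit_weight_equiv :: "(nat \<Rightarrow> nat \<Rightarrow> 'c) \<Rightarrow> (nat \<Rightarrow> nat \<Rightarrow> 'c) \<Rightarrow> bool" where
  "unit_weight_equiv a b \<longleftrightarrow> (a = \<zero>\<^bsub>P\<^esub> \<longleftrightarrow> b = \<zero>\<^bsub>P\<^esub>) \<and> (\<forall>i<t. unit_wt a i = unit_wt b i)"

lemma mem_socle_block: "a \<in> socle_block m \<longleftrightarrow> a \<in> lsoc P \<and> (\<forall>i<t. wt n S a i = m i)"
  by (simp add: weight_block_def lsoc_P wt_eq_weight_outside)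

lemma mem_unit_block: "a \<in> unit_block m \<longleftrightarrow> a \<in> carrier P \<and> (\<forall>i<t. unit_wt a i = m i)"
  by (simp add: weight_block_def carrier_P)

lemma mem_jrad_P_iff: "a \<in> jrad P \<longleftrightarrow> a \<in> carrier P \<and> (\<forall>i<t. unit_wt a i = 0)"
  using mem_box_iff[of a "\<lambda>i j. jrad (S i j)"] jrad_closed[of a P]
  unfolding weight_outside_eq_0_iff jrad_P by blast

lemma zero_in_jrad_P: "\<zero>\<^bsub>P\<^esub> \<in> jrad P"
  by (rule left_ideal_zero[OF P.left_ideal_jrad])

lemma mem_H'_iff: "B \<in> H' t n S \<longleftrightarrow> B \<noteq> {} \<and> (B = carrier P - lsoc P \<or> (\<exists>m. B = socle_block m))"
proof -
  have block: "{a \<in> lsoc P. \<forall>i<t. wt n S a i = m i} = socle_block m" for m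
    by (auto simp: mem_socle_block)
  have "in_M t n m" if "socle_block m \<noteq> {}" for m
    using that in_M_if_weight_block by blast
  then show ?thesis unfolding H'_def mem_Collect_eq block by blast
qed

lemma mem_H'_dual_iff:
  "B \<in> H'_dual t n S \<longleftrightarrow> B \<noteq> {} \<and>
    (B = jrad P - {\<zero>\<^bsub>P\<^esub>} \<or> B = {\<zero>\<^bsub>P\<^esub>} \<or> (\<exists>m. (\<exists>i<t. m i \<noteq> 0) \<and> B = unit_block m))"
proof -
  have unit_wt: "card {j. j < n i \<and> a i j \<notin> jrad (S i j)} = unit_wt a i" for a i
    by (simp add: weight_outside_def)
  have "{a \<in> carrier P - jrad P. \<forall>i<t. unit_wt a i = m i} = unit_block m"
    if "\<exists>i<t. m i \<noteq> 0" for m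
    using that by (auto simp: mem_unit_block mem_jrad_P_iff)
  then have block: "(\<exists>i<t. m i \<noteq> 0) \<and> B = {a \<in> carrier P - jrad P. \<forall>i<t. unit_wt a i = m i}
      \<longleftrightarrow> (\<exists>i<t. m i \<noteq> 0) \<and> B = unit_block m" for m
    by (intro conj_cong refl) (simp only:)
  have "in_M t n m" if "unit_block m \<noteq> {}" for m
    using that in_M_if_weight_block by blast
  then show ?thesis unfolding H'_dual_def mem_Collect_eq unit_wt block by blast
qed

lemma H'_eq_partition_by: "H' t n S = partition_by (carrier P) socle_weight_equiv"
proof (rule eq_partition_byI)
  show "\<Union>(H' t n S) = carrier P"
  proof (intro equalityI subsetI)
    fix a assume "a \<in> carrier P"
    then have "a \<in> carrier P - lsoc P \<or> a \<in> socle_block (wt n S a)" by (simp add: mem_socle_block)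
    then show "a \<in> \<Union>(H' t n S)" using mem_H'_iff by blast
  qed (auto simp: mem_H'_iff mem_socle_block lsoc_P_closed)
  fix B a assume "B \<in> H' t n S" "a \<in> B"
  then consider "B = carrier P - lsoc P" | m where "B = socle_block m" by (auto simp: mem_H'_iff)
  then show "B = {b \<in> carrier P. socle_weight_equiv a b}"
    using \<open>a \<in> B\<close> lsoc_P_closed by cases (auto simp: socle_weight_equiv_def mem_socle_block)
qed (simp add: mem_H'_iff)

lemma H'_dual_eq_partition_by: "H'_dual t n S = partition_by (carrier P) unit_weight_equiv"
proof (rule eq_partition_byI)
  show "\<Union>(H'_dual t n S) = carrier P"
  proof (intro equalityI subsetI)
    fix a assume a: "a \<in> carrier P"
    consider "a = \<zero>\<^bsub>P\<^esub>" | "a \<in> jrad P - {\<zero>\<^bsub>P\<^esub>}" | "\<exists>i<t. unit_wt a i \<noteq> 0"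
      using a mem_jrad_P_iff[of a] by blast
    then have "\<exists>B. a \<in> B \<and> B \<in> H'_dual t n S"
    proof cases
      case 3
      then show ?thesis
        using a by (intro exI[of _ "unit_block (unit_wt a)"]) (auto simp: mem_H'_dual_iff mem_unit_block)
    qed (use mem_H'_dual_iff in blast)+
    then show "a \<in> \<Union>(H'_dual t n S)" by blast
  qed (auto simp: mem_H'_dual_iff mem_unit_block jrad_closed)
  fix B a assume "B \<in> H'_dual t n S" "a \<in> B"
  then consider "B = jrad P - {\<zero>\<^bsub>P\<^esub>}" | "B = {\<zero>\<^bsub>P\<^esub>}" | m where "\<exists>i<t. m i \<noteq> 0" "B = unit_block m"
    by (auto simp: mem_H'_dual_iff)
  then show "B = {b \<in> carrier P. unit_weight_equiv a b}"
  proof cases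
    case 1
    then show ?thesis
      using \<open>a \<in> B\<close> by (auto simp: unit_weight_equiv_def mem_jrad_P_iff)
  next
    case 2
    then show ?thesis using \<open>a \<in> B\<close> by (auto simp: unit_weight_equiv_def)
  next
    case 3
    have "\<not> (\<forall>i<t. unit_wt \<zero>\<^bsub>P\<^esub> i = m i)"
      using 3(1) zero_in_jrad_P by (auto simp: mem_jrad_P_iff)
    then have "a \<noteq> \<zero>\<^bsub>P\<^esub>" "\<forall>b\<in>unit_block m. b \<noteq> \<zero>\<^bsub>P\<^esub>"
      using \<open>a \<in> B\<close> 3(2) by (auto simp: mem_unit_block)
    then show ?thesis
      using \<open>a \<in> B\<close> 3(2) by (auto simp: unit_weight_equiv_def mem_unit_block)
  qed
qed (simp add: mem_H'_dual_iff)

lemma P_hom_eq_H':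
  assumes "separating t n q"
  shows "P_hom P = H' t n S"
proof -
  have "P_hom P = partition_by (carrier P) (\<lambda>a b. hom_weight P b = hom_weight P a)"
    by (simp add: P_hom_def partition_by_def)
  also have "\<dots> = H' t n S"
    unfolding H'_eq_partition_by using hom_weight_eq_iff[OF assms] by (intro partition_by_cong) metis
  finally show ?thesis .
qed

lemma jrad_component_semisimple:
  assumes semisimple: "carrier P = lsoc P" and ij: "in_idx t n i j"
  shows "jrad (S i j) = {\<zero>\<^bsub>S i j\<^esub>}"
proof -
  interpret C: simple_socle_ring "S i j" by (rule simple_socle_component[OF ij])
  have "\<one>\<^bsub>P\<^esub> i j \<in> lsoc (S i j)"
    using lsoc_P_iff[OF P.one_closed] semisimple ij by auto
  then have "r \<otimes>\<^bsub>S i j\<^esub> \<one>\<^bsub>S i j\<^esub> = \<zero>\<^bsub>S i j\<^esub>" if "r \<in> jrad (S i j)" for r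
    using that ij by (simp add: P_apply C.lsoc_eq)
  then show ?thesis
    using jrad_closed[of _ "S i j"] left_ideal_zero[OF C.left_ideal_jrad] by fastforce
qed

lemma H'_dual_semisimple:
  assumes semisimple: "carrier P = lsoc P"
  shows "H'_dual t n S = H' t n S"
  unfolding H'_dual_eq_partition_by H'_eq_partition_by
proof (rule partition_by_cong)
  fix a b assume ab: "a \<in> carrier P" "b \<in> carrier P"
  have wt: "unit_wt c i = wt n S c i" if "i < t" for c i
    unfolding wt_eq_weight_outside weight_outside_def
    using jrad_component_semisimple[OF semisimple, of i] that
    by (intro arg_cong[of _ _ card] Collect_cong) (auto simp: in_idx_def)
  have "c = \<zero>\<^bsub>P\<^esub> \<longleftrightarrow> (\<forall>i<t. unit_wt c i = 0)" if c: "c \<in> carrier P" for c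
  proof
    assume "\<forall>i<t. unit_wt c i = 0"
    then show "c = \<zero>\<^bsub>P\<^esub>"
      using jrad_component_semisimple[OF semisimple]
      by (intro P_eqI c P.zero_closed) (auto simp: weight_outside_eq_0_iff P_apply)
  qed (use zero_in_jrad_P in \<open>simp add: mem_jrad_P_iff\<close>)
  then show "unit_weight_equiv a b \<longleftrightarrow> socle_weight_equiv a b"
    using ab semisimple by (auto simp: unit_weight_equiv_def socle_weight_equiv_def wt)
qed

lemma H'_eq_hamming_prod: "carrier P = lsoc P \<Longrightarrow> H' t n S = hamming_prod t n S"
  by (auto simp: H'_def hamming_prod_def)

lemma H'_sums_eq_iff:
  fixes f g :: "(nat \<Rightarrow> nat \<Rightarrow> 'c) \<Rightarrow> complex"
  shows "(\<forall>B\<in>H' t n S. sum f B = sum g B)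
    \<longleftrightarrow> (\<forall>m. sum f (socle_block m) = sum g (socle_block m)) \<and> sum f (carrier P) = sum g (carrier P)"
proof -
  have "(\<forall>B\<in>H' t n S. sum f B = sum g B) \<longleftrightarrow> (\<forall>m. sum f (socle_block m) = sum g (socle_block m))
      \<and> sum f (carrier P - lsoc P) = sum g (carrier P - lsoc P)"
    using sum.empty[of f] sum.empty[of g] by (metis mem_H'_iff)
  moreover have "sum h (carrier P - lsoc P) = sum h (carrier P) - sum h (lsoc P)"
    for h :: "(nat \<Rightarrow> nat \<Rightarrow> 'c) \<Rightarrow> complex"
    using lsoc_P_closed by (intro sum_diff P.finite_carrier) auto
  moreover have "sum f (lsoc P) = sum g (lsoc P)" if "\<forall>m. sum f (socle_block m) = sum g (socle_block m)"
    using that P.finite_left_ideal[OF P.left_ideal_lsoc] unfolding lsoc_P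
    by (intro sum_box_eq_if_sum_weight_blocks_eq) blast+
  ultimately show ?thesis by auto
qed

lemma H'_dual_sums_eq_iff:
  fixes f g :: "(nat \<Rightarrow> nat \<Rightarrow> 'c) \<Rightarrow> complex"
  assumes zero: "f \<zero>\<^bsub>P\<^esub> = g \<zero>\<^bsub>P\<^esub>"
  shows "(\<forall>B\<in>H'_dual t n S. sum f B = sum g B) \<longleftrightarrow> (\<forall>m. sum f (unit_block m) = sum g (unit_block m))"
proof -
  have "(\<forall>B\<in>H'_dual t n S. sum f B = sum g B) \<longleftrightarrow> (\<forall>B. B = jrad P - {\<zero>\<^bsub>P\<^esub>} \<or> B = {\<zero>\<^bsub>P\<^esub>}
      \<or> (\<exists>m. (\<exists>i<t. m i \<noteq> 0) \<and> B = unit_block m) \<longrightarrow> sum f B = sum g B)"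
    unfolding Ball_def mem_H'_dual_iff by (intro iff_allI) (metis sum.empty)
  also have "\<dots> \<longleftrightarrow> sum f (jrad P - {\<zero>\<^bsub>P\<^esub>}) = sum g (jrad P - {\<zero>\<^bsub>P\<^esub>})
      \<and> (\<forall>m. (\<exists>i<t. m i \<noteq> 0) \<longrightarrow> sum f (unit_block m) = sum g (unit_block m))"
    using zero by (simp add: imp_disjL all_conj_distrib) blast
  also have "sum f (jrad P - {\<zero>\<^bsub>P\<^esub>}) = sum g (jrad P - {\<zero>\<^bsub>P\<^esub>}) \<longleftrightarrow> sum f (jrad P) = sum g (jrad P)"
    using P.finite_left_ideal[OF P.left_ideal_jrad] zero_in_jrad_P zero by (simp add: sum_diff1)
  also have "sum f (jrad P) = sum g (jrad P)
      \<and> (\<forall>m. (\<exists>i<t. m i \<noteq> 0) \<longrightarrow> sum f (unit_block m) = sum g (unit_block m))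
    \<longleftrightarrow> (\<forall>m. sum f (unit_block m) = sum g (unit_block m))" (is "?J \<and> ?U \<longleftrightarrow> ?all")
  proof -
    have jrad: "unit_block m = jrad P" if "\<not> (\<exists>i<t. m i \<noteq> 0)" for m
      using that by (auto simp: mem_unit_block mem_jrad_P_iff)
    have "?J" if ?all using spec[OF that, of "\<lambda>_. 0"] jrad by simp
    moreover have "sum f (unit_block m) = sum g (unit_block m)" if "?J \<and> ?U" for m
      using that jrad[of m] by (cases "\<exists>i<t. m i \<noteq> 0") simp_all
    ultimately show ?thesis by blast
  qed
  finally show ?thesis .
qed

lemma sum_socle_block:
  fixes g :: "nat \<Rightarrow> nat \<Rightarrow> 'c \<Rightarrow> complex"
  assumes zero: "\<And>i j. in_idx t n i j \<Longrightarrow> g i j \<zero>\<^bsub>S i j\<^esub> = 1"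
    and lsoc: "\<And>i j. in_idx t n i j \<Longrightarrow> sum (g i j) (lsoc (S i j) - {\<zero>\<^bsub>S i j\<^esub>})
      = (if a i j \<in> jrad (S i j) then of_nat (q i) - 1 else - 1)"
  shows "(\<Sum>b\<in>socle_block m. \<Prod>(i, j)\<in>idx t n. g i j (b i j)) = krawtchouk_value t n q (\<lambda>i j. jrad (S i j)) a m"
proof -
  have "(\<Prod>(i, j)\<in>idx t n. sum (g i j) {\<zero>\<^bsub>S i j\<^esub>}) = 1"
    by (rule prod.neutral) (auto simp: zero)
  then show ?thesis
    unfolding krawtchouk_value_def
    by (subst sum_weight_block[where c = "\<lambda>i j. if a i j \<in> jrad (S i j) then of_nat (q i) - 1 else - 1"])
      (auto simp: zero lsoc left_ideal_zero[OF left_ideal_lsoc_component]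
        finite_ring.finite_left_ideal[OF finite_component left_ideal_lsoc_component])
qed

lemma card_jrad_component_pos: "in_idx t n i j \<Longrightarrow> card (jrad (S i j)) > 0"
  by (rule finite_ring.card_left_ideal_pos[OF finite_component left_ideal_jrad_component])

lemma krawtchouk_multiples_eq_iff_weights:
  "(\<forall>m. z * krawtchouk_value t n q Z a m = z' * krawtchouk_value t n q Z b m)
    \<longleftrightarrow> z = z' \<and> (z \<noteq> 0 \<longrightarrow> (\<forall>i<t. weight_outside n Z a i = weight_outside n Z b i))"
  by (rule krawtchouk_multiples_eq_iff) (use q_ge_2 in fastforce)

end

locale simple_socle_product_character =
  simple_socle_product t n q S + P: nondegenerate_character "prod_ring t n S" \<chi> for t n q S \<chi>
begin

definition component_char :: "nat \<Rightarrow> nat \<Rightarrow> 'a \<Rightarrow> complex" where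
  "component_char i j x = \<chi> (emb i j x)"

lemma component_char_zero: "in_idx t n i j \<Longrightarrow> component_char i j \<zero>\<^bsub>S i j\<^esub> = 1"
  by (simp add: component_char_def emb_zero P.character_zero)

lemma component_char_add:
  "in_idx t n i j \<Longrightarrow> x \<in> carrier (S i j) \<Longrightarrow> y \<in> carrier (S i j) \<Longrightarrow>
    component_char i j (x \<oplus>\<^bsub>S i j\<^esub> y) = component_char i j x * component_char i j y"
  by (simp add: component_char_def emb_add P.character_add emb_closed)

lemma simple_socle_character_component:
  assumes ij: "in_idx t n i j"
  shows "simple_socle_character (S i j) (component_char i j)"
proof -
  interpret simple_socle_ring "S i j" by (rule simple_socle_component[OF ij])
  show ?thesis
  proof unfold_locales
    fix x assume x: "x \<in> carrier (S i j)" "x \<noteq> \<zero>\<^bsub>S i j\<^esub>"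
    then have "emb i j x \<noteq> \<zero>\<^bsub>P\<^esub>" using emb_zero[OF ij] injD[OF inj_emb[OF ij]] by metis
    then obtain r where r: "r \<in> carrier P" "\<chi> (r \<otimes>\<^bsub>P\<^esub> emb i j x) \<noteq> 1"
      using P.left_nondegenerate emb_closed[OF x(1)] by blast
    then show "\<exists>r\<in>carrier (S i j). component_char i j (r \<otimes>\<^bsub>S i j\<^esub> x) \<noteq> 1"
      using mult_emb_right[OF ij x(1) r(1)] carrier_P_component[OF r(1) ij]
      by (auto simp: component_char_def)
  qed (simp_all add: component_char_zero component_char_add ij)
qed

lemma character_eq_prod:
  assumes a: "a \<in> carrier P"
  shows "\<chi> a = (\<Prod>(i, j)\<in>idx t n. component_char i j (a i j))"
proof -
  define \<phi> where "\<phi> a = (\<Prod>(i, j)\<in>idx t n. component_char i j (a i j))" for a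
  have "\<chi> a = \<phi> a"
  proof (rule P_emb_induct[OF a, of "\<lambda>a. \<chi> a = \<phi> a"])
    show "\<chi> \<zero>\<^bsub>P\<^esub> = \<phi> \<zero>\<^bsub>P\<^esub>"
      unfolding \<phi>_def by (subst prod.neutral) (auto simp: P.character_zero P_apply component_char_zero)
    fix i j b assume ij: "in_idx t n i j" and b: "b \<in> carrier P" "\<chi> b = \<phi> b"
    let ?e = "emb i j (a i j)"
    have e: "?e \<in> carrier P" by (rule emb_closed[OF carrier_P_component[OF a ij]])
    have "\<phi> ?e = component_char i j (?e i j) * (\<Prod>(i', j')\<in>idx t n - {(i, j)}. component_char i' j' (?e i' j'))"
      unfolding \<phi>_def by (subst prod.remove[OF finite_idx, of "(i, j)"]) (simp_all add: ij)
    also have "(\<Prod>(i', j')\<in>idx t n - {(i, j)}. component_char i' j' (?e i' j')) = 1"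
      by (rule prod.neutral) (auto simp: emb_def component_char_zero split: if_splits)
    finally have "\<phi> ?e = \<chi> ?e" by (simp add: emb_apply ij component_char_def)
    moreover have "\<phi> (?e \<oplus>\<^bsub>P\<^esub> b) = \<phi> ?e * \<phi> b"
      unfolding \<phi>_def prod.distrib[symmetric]
      by (rule prod.cong[OF refl])
        (use e b(1) in \<open>auto simp: P_apply component_char_add carrier_P_component\<close>)
    ultimately show "\<chi> (?e \<oplus>\<^bsub>P\<^esub> b) = \<phi> (?e \<oplus>\<^bsub>P\<^esub> b)"
      using P.character_add[OF e b(1)] b(2) by simp
  qed
  then show ?thesis by (simp add: \<phi>_def)
qed

lemma character_mult_eq_prod:
  assumes "a \<in> carrier P" "b \<in> carrier P"
  shows "\<chi> (a \<otimes>\<^bsub>P\<^esub> b) = (\<Prod>(i, j)\<in>idx t n. component_char i j (a i j \<otimes>\<^bsub>S i j\<^esub> b i j))"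
  unfolding character_eq_prod[OF P.m_closed[OF assms]] by (rule prod_idx_cong) (simp add: P_apply)

lemma sum_character_socle_block:
  assumes a: "a \<in> carrier P"
  shows "(\<Sum>b\<in>socle_block m. \<chi> (b \<otimes>\<^bsub>P\<^esub> a)) = krawtchouk_value t n q (\<lambda>i j. jrad (S i j)) a m" (is ?left)
    and "(\<Sum>b\<in>socle_block m. \<chi> (a \<otimes>\<^bsub>P\<^esub> b)) = krawtchouk_value t n q (\<lambda>i j. jrad (S i j)) a m" (is ?right)
proof -
  have closed: "b \<in> carrier P" if "b \<in> socle_block m" for b
    using that lsoc_P_closed by (simp add: mem_socle_block)
  note lsoc = simple_socle_character.sum_character_lsoc[OF simple_socle_character_component]
  have "(\<Sum>b\<in>socle_block m. \<chi> (b \<otimes>\<^bsub>P\<^esub> a))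
      = (\<Sum>b\<in>socle_block m. \<Prod>(i, j)\<in>idx t n. component_char i j (b i j \<otimes>\<^bsub>S i j\<^esub> a i j))"
    using closed a by (intro sum.cong refl character_mult_eq_prod)
  then show ?left
    using carrier_P_component[OF a]
    by (simp only:)
      (rule sum_socle_block, simp_all add: component_char_zero component_simps lsoc card_lsoc_component)
  have "(\<Sum>b\<in>socle_block m. \<chi> (a \<otimes>\<^bsub>P\<^esub> b))
      = (\<Sum>b\<in>socle_block m. \<Prod>(i, j)\<in>idx t n. component_char i j (a i j \<otimes>\<^bsub>S i j\<^esub> b i j))"
    using closed a by (intro sum.cong refl character_mult_eq_prod)
  then show ?right
    using carrier_P_component[OF a]
    by (simp only:)
      (rule sum_socle_block, simp_all add: component_char_zero component_simps lsoc card_lsoc_component)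
qed

definition radical_sum :: "(nat \<Rightarrow> nat \<Rightarrow> 'a) \<Rightarrow> complex" where
  "radical_sum a = (\<Prod>(i, j)\<in>idx t n. \<Sum>y\<in>jrad (S i j). component_char i j (y \<otimes>\<^bsub>S i j\<^esub> a i j))"

lemma radical_sum_eq:
  assumes a: "a \<in> carrier P"
  shows "radical_sum a = (if a \<in> lsoc P then \<Prod>(i, j)\<in>idx t n. of_nat (card (jrad (S i j))) else 0)"
proof -
  have "radical_sum a = (\<Prod>(i, j)\<in>idx t n. if a i j \<in> lsoc (S i j) then of_nat (card (jrad (S i j))) else 0)"
    unfolding radical_sum_def
    by (intro prod_idx_cong simple_socle_character.sum_character_jrad simple_socle_character_component
        carrier_P_component[OF a])
  also have "\<dots> = (if a \<in> lsoc P then \<Prod>(i, j)\<in>idx t n. of_nat (card (jrad (S i j))) else 0)"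
  proof (cases "a \<in> lsoc P")
    case True
    then show ?thesis using lsoc_P_iff[OF a] by (auto intro!: prod_idx_cong)
  next
    case False
    then show ?thesis using lsoc_P_iff[OF a] by (auto simp: prod_idx_eq_0_iff)
  qed
  finally show ?thesis .
qed

lemma radical_sum_eq_0_iff: "a \<in> carrier P \<Longrightarrow> radical_sum a = 0 \<longleftrightarrow> a \<notin> lsoc P"
  using card_jrad_component_pos by (auto simp: radical_sum_eq prod_idx_eq_0_iff)

lemma sum_character_unit_block:
  assumes a: "a \<in> carrier P"
  shows "(\<Sum>b\<in>unit_block m. \<chi> (b \<otimes>\<^bsub>P\<^esub> a))
    = radical_sum a * krawtchouk_value t n q (\<lambda>i j. {\<zero>\<^bsub>S i j\<^esub>}) a m"
proof -
  have "(\<Sum>b\<in>unit_block m. \<chi> (b \<otimes>\<^bsub>P\<^esub> a))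
      = (\<Sum>b\<in>unit_block m. \<Prod>(i, j)\<in>idx t n. component_char i j (b i j \<otimes>\<^bsub>S i j\<^esub> a i j))"
    by (rule sum.cong) (use a in \<open>simp_all add: character_mult_eq_prod mem_unit_block\<close>)
  also have "\<dots> = radical_sum a * krawtchouk_value t n q (\<lambda>i j. {\<zero>\<^bsub>S i j\<^esub>}) a m"
    unfolding radical_sum_def krawtchouk_value_def
  proof (rule sum_weight_block)
    fix i j assume ij: "in_idx t n i j"
    interpret C: simple_socle_character "S i j" "component_char i j"
      by (rule simple_socle_character_component[OF ij])
    show "jrad (S i j) \<subseteq> carrier (S i j)" by (auto simp: jrad_closed)
    show "finite (carrier (S i j))" by (rule C.finite_carrier)
    show "(\<Sum>y\<in>carrier (S i j) - jrad (S i j). component_char i j (y \<otimes>\<^bsub>S i j\<^esub> a i j))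
        = (if a i j \<in> {\<zero>\<^bsub>S i j\<^esub>} then of_nat (q i) - 1 else - 1)
          * (\<Sum>y\<in>jrad (S i j). component_char i j (y \<otimes>\<^bsub>S i j\<^esub> a i j))"
      using C.sum_character_nonradical[OF carrier_P_component[OF a ij]]
      by (simp add: card_lsoc_component[OF ij])
  qed
  finally show ?thesis .
qed

lemma unit_weight_equiv_iff_sums:
  assumes ab: "a \<in> carrier P" "b \<in> carrier P"
  shows "unit_weight_equiv a b \<longleftrightarrow> (\<forall>B\<in>H' t n S. (\<Sum>x\<in>B. \<chi> (x \<otimes>\<^bsub>P\<^esub> a)) = (\<Sum>x\<in>B. \<chi> (x \<otimes>\<^bsub>P\<^esub> b)))"
    and "unit_weight_equiv a b \<longleftrightarrow> (\<forall>B\<in>H' t n S. (\<Sum>x\<in>B. \<chi> (a \<otimes>\<^bsub>P\<^esub> x)) = (\<Sum>x\<in>B. \<chi> (b \<otimes>\<^bsub>P\<^esub> x)))"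
proof -
  note krawtchouk = krawtchouk_multiples_eq_iff_weights[of 1 "\<lambda>i j. jrad (S i j)" a 1 b, simplified]
    and card = P.card_left_ideal_pos[OF P.left_ideal_carrier]
  show "unit_weight_equiv a b \<longleftrightarrow> (\<forall>B\<in>H' t n S. (\<Sum>x\<in>B. \<chi> (x \<otimes>\<^bsub>P\<^esub> a)) = (\<Sum>x\<in>B. \<chi> (x \<otimes>\<^bsub>P\<^esub> b)))"
    unfolding H'_sums_eq_iff sum_character_socle_block(1)[OF ab(1)] sum_character_socle_block(1)[OF ab(2)]
      P.sum_character_carrier(1)[OF ab(1)] P.sum_character_carrier(1)[OF ab(2)] krawtchouk
    using card by (auto simp: unit_weight_equiv_def)
  show "unit_weight_equiv a b \<longleftrightarrow> (\<forall>B\<in>H' t n S. (\<Sum>x\<in>B. \<chi> (a \<otimes>\<^bsub>P\<^esub> x)) = (\<Sum>x\<in>B. \<chi> (b \<otimes>\<^bsub>P\<^esub> x)))"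
    unfolding H'_sums_eq_iff sum_character_socle_block(2)[OF ab(1)] sum_character_socle_block(2)[OF ab(2)]
      P.sum_character_carrier(2)[OF ab(1)] P.sum_character_carrier(2)[OF ab(2)] krawtchouk
    using card by (auto simp: unit_weight_equiv_def)
qed

lemma left_dual_H': "left_dual P \<chi> (H' t n S) = H'_dual t n S"
  unfolding left_dual_eq_partition_by H'_dual_eq_partition_by
  by (rule partition_by_cong) (simp only: unit_weight_equiv_iff_sums(1))

lemma right_dual_H': "right_dual P \<chi> (H' t n S) = H'_dual t n S"
  unfolding right_dual_eq_partition_by H'_dual_eq_partition_by
  by (rule partition_by_cong) (simp only: unit_weight_equiv_iff_sums(2))

lemma socle_weight_equiv_iff_sums:
  assumes ab: "a \<in> carrier P" "b \<in> carrier P"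
  shows "socle_weight_equiv a b
    \<longleftrightarrow> (\<forall>B\<in>H'_dual t n S. (\<Sum>x\<in>B. \<chi> (x \<otimes>\<^bsub>P\<^esub> a)) = (\<Sum>x\<in>B. \<chi> (x \<otimes>\<^bsub>P\<^esub> b)))"
proof -
  have "radical_sum a = radical_sum b \<longleftrightarrow> (a \<in> lsoc P \<longleftrightarrow> b \<in> lsoc P)"
    using radical_sum_eq_0_iff[OF ab(1)] radical_sum_eq_0_iff[OF ab(2)]
      radical_sum_eq[OF ab(1)] radical_sum_eq[OF ab(2)] by auto
  then show ?thesis
    using ab by (simp add: H'_dual_sums_eq_iff sum_character_unit_block krawtchouk_multiples_eq_iff_weights
        radical_sum_eq_0_iff socle_weight_equiv_def wt_eq_weight_outside P.character_zero)
qed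

lemma left_dual_H'_dual: "left_dual P \<chi> (H'_dual t n S) = H' t n S"
  unfolding left_dual_eq_partition_by H'_eq_partition_by
  by (rule partition_by_cong) (simp only: socle_weight_equiv_iff_sums)

end

lemma (in simple_socle_product) simple_socle_product_character_if_generating:
  "generating_char P \<chi> \<Longrightarrow> simple_socle_product_character t n q S \<chi>"
  by (intro simple_socle_product_character.intro simple_socle_product_axioms
      P.nondegenerate_character_if_generating)

theorem theorem4p4:
  fixes t :: nat and n q :: "nat \<Rightarrow> nat"
    and S :: "nat \<Rightarrow> nat \<Rightarrow> ('c, 'm) ring_scheme"
  assumes comps: "\<And>i j. i < t \<Longrightarrow> j < n i \<Longrightarrow>
        ring (S i j) \<and> finite (carrier (S i j)) \<and> local_ring (S i j) \<and> frobenius (S i j)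
        \<and> card (a_rcosets\<^bsub>S i j\<^esub> (jrad (S i j))) = q i \<and> card (lsoc (S i j)) = q i"
    and n_pos: "\<And>i. i < t \<Longrightarrow> 1 \<le> n i"
    and q_distinct: "inj_on q {..<t}"
    and sep: "separating t n q"
  shows "P_hom (prod_ring t n S) = H' t n S
     \<and> (\<forall>\<chi>. generating_char (prod_ring t n S) \<chi> \<longrightarrow>
           reflexive_partition (prod_ring t n S) \<chi> (P_hom (prod_ring t n S))
         \<and> left_dual (prod_ring t n S) \<chi> (P_hom (prod_ring t n S)) = H'_dual t n S
         \<and> right_dual (prod_ring t n S) \<chi> (P_hom (prod_ring t n S)) = H'_dual t n S)
     \<and> (carrier (prod_ring t n S) = lsoc (prod_ring t n S) \<longrightarrow>
           P_hom (prod_ring t n S) = hamming_prod t n S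
         \<and> (\<forall>\<chi>. generating_char (prod_ring t n S) \<chi> \<longrightarrow>
               self_dual_partition (prod_ring t n S) \<chi> (P_hom (prod_ring t n S))))"
proof -
  interpret simple_socle_product t n q S
  proof (rule simple_socle_product.intro)
    fix i j assume "in_idx t n i j"
    then have "i < t" "j < n i" by (simp_all add: in_idx_def)
    from comps[OF this] show "simple_socle_ring (S i j)" "card (lsoc (S i j)) = q i"
      by (simp_all add: simple_socle_ring_def simple_socle_ring_axioms_def
          finite_local_ring_def finite_local_ring_axioms_def finite_ring_def finite_ring_axioms_def)
  qed
  have duals: "left_dual P \<chi> (H' t n S) = H'_dual t n S" "right_dual P \<chi> (H' t n S) = H'_dual t n S"
    "left_dual P \<chi> (H'_dual t n S) = H' t n S" if "generating_char P \<chi>" for \<chi>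
  proof -
    interpret simple_socle_product_character t n q S \<chi>
      by (rule simple_socle_product_character_if_generating[OF that])
    show "left_dual P \<chi> (H' t n S) = H'_dual t n S" "right_dual P \<chi> (H' t n S) = H'_dual t n S"
      "left_dual P \<chi> (H'_dual t n S) = H' t n S"
      by (fact left_dual_H' right_dual_H' left_dual_H'_dual)+
  qed
  show ?thesis
    unfolding P_hom_eq_H'[OF sep] reflexive_partition_def self_dual_partition_def
    using duals H'_dual_semisimple H'_eq_hamming_prod by auto
qed

end
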